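(* Let $\gamma\ge 1$ and let $\tilde{\mathcal K}^\pm=\tilde{\mathcal K}^\pm(t,x_1,x_3)$ (defined for $\pm x_3>0$) satisfy $$\lim_{x_3\to+\infty}\hat{\mathcal K}^\pm(\cdot,\pm x_3)=0 .$$ Assume that $\tilde f=\tilde f(t,x_1)$, $\tilde h^\pm=\tilde h^\pm(t,x_1,x_3)$, $\tilde B_2^\pm=\tilde B_2^\pm(t,x_1,x_3)$ (the latter two defined for $\pm x_3\ge 0$) solve the front equation on $\{x_3=0\}$ $$(\gamma+\partial_t)^2\tilde f+(\dot v_1^+)^2\partial_{11}^2\tilde f+\tfrac12 c^2(\partial_3\tilde h^++\partial_3\tilde h^-)+\tfrac12\Big(\tfrac{\dot B_2^+}{\dot\varrho}\partial_3\tilde B_2^++\tfrac{\dot B_2^-}{\dot\varrho}\partial_3\tilde B_2^-\Big)=0$$ together with $$\begin{cases}(\gamma+\partial_t+\dot v_1^\pm\partial_1)^2\tilde h^\pm-c^2(\partial_{11}^2+\partial_{33}^2)\tilde h^\pm-\frac{\dot B_2^\pm}{\dot\varrho}(\partial_{11}^2+\partial_{33}^2)\tilde B_2^\pm=\tilde{\mathcal K}^\pm & \text{in } \pm x_3>0,\\ (\gamma+\partial_t+\dot v_1^\pm\partial_1)^2\tilde B_2^\pm-\dot B_2^\pm(\gamma+\partial_t+\dot v_1^\pm\partial_1)^2\tilde h^\pm=0 & \text{in } \pm x_3>0,\\ [\,c^2\tilde h+\dot\varrho^{-1}\dot B_2\tilde B_2\,]=0 & \text{on } x_3=0,\\ [\,c^2\partial_3\tilde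 h+\dot\varrho^{-1}\dot B_2\partial_3\tilde B_2\,]=-4\dot v_1^+(\gamma+\partial_t)\partial_1\tilde f & \text{on } x_3=0,\end{cases}$$ and that $$\lim_{x_3\to+\infty}\hat h^\pm(\cdot,\pm x_3)=0 .$$ Then, with $\tau=\gamma+i\delta$, $\hat f$ solves the second order pseudo-differential equation $$\Big(\tau^2-(\dot v_1^+)^2\eta^2-2i\tau\eta\,\dot v_1^+\frac{\mu^+-\mu^-}{\mu^++\mu^-}\Big)\hat f+\frac{\mu^+\mu^-}{\mu^++\mu^-}W=0,$$ where $\mu^\pm=\sqrt{\frac{(\tau+i\dot v_1^\pm\eta)^2}{\bar C_B^2}+\eta^2}$ is such that $\Re\mu^\pm>0$ if $\Re\tau>0$, $\bar C_B^2=c^2+c_A^2$, and $$W=W(\tau,\eta)=\frac1{\mu^+\bar C_B^2}\int_0^\infty e^{-\mu^+y}\hat{\mathcal K}^+(\cdot,y)\,dy-\frac1{\mu^-\bar C_B^2}\int_0^\infty e^{-\mu^-y}\hat{\mathcal K}^-(\cdot,-y)\,dy .$$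
   Context: Constants (background rectilinear flow): $\dot\varrho>0$ is the density on both sides; $\dot v_1^\pm\in\mathbb R$ with $\dot v_1^-=-\dot v_1^+$; $\dot B_2^\pm\in\mathbb R$ with $|\dot B_2^+|=|\dot B_2^-|$; $c=\sqrt{p'(\dot\varrho)}>0$ is the sound speed, for a pressure law $p$ with $p'>0$. Set $c_A^2=(\dot B_2^\pm)^2/\dot\varrho$ (the same on both sides), $\bar C_B^2=c^2+c_A^2$, $\bar C_B>0$. Here $\gamma\ge1$ is the exponential weight in time; $\tilde f,\tilde h,\tilde B_2,\tilde{\mathcal K}$ stand for $e^{-\gamma t}f,e^{-\gamma t}h,e^{-\gamma t}B_2,e^{-\gamma t}\mathcal K$. Variables: $t,x_1\in\mathbb R$ and $x_3$. The jump across $x_3=0$ is $[\phi]=\phi^+|_{x_3=0}-\phi^-|_{x_3=0}$, where constants such as $\dot B_2$ also carry their $\pm$ values. $\hat f,\hat h^\pm,\hat B_2^\pm,\hat{\mathcal K}^\pm$ are the Fourier transforms of $\tilde f,\tilde h^\pm,\tilde B_2^\pm,\tilde{\mathcal K}^\pm$ in $(t,x_1)$, with dual variables $(\delta,\eta)\in\mathbb R^2$ (so $\partial_t\mapsto i\delta$, $\partial_1\mapsto i\eta$); $x_3$ is kept as a parameter and "$\cdot$" stands for $(\delta,\eta)$. Solutions are understood to be regular enough for the Fourier-transformed system, the boundary values at $x_3=0$ and the limits to make sense.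
   Formalization: The last term of the equation is proved with an extra factor $\bar C_B^2$, i.e. $\frac{\mu^+\mu^-}{\mu^++\mu^-}\bar C_B^2W$ with $W$ as printed; the printed equation fails in general when $\bar C_B\ne1$ (e.g. $\dot v_1^\pm=\dot B_2^\pm=0$, $h$ odd in $x_3$). *)

theory Defs
  imports "HOL-Analysis.Analysis"
begin

text \<open>
  Functions of \<open>(t, x\<^sub>1)\<close> are curried as \<open>u t x\<close>. Functions of \<open>(t, x\<^sub>1, x\<^sub>3)\<close> take the parameter
  \<open>x\<^sub>3\<close> first, \<open>\<phi> z t x\<close>, so that \<open>\<phi> z\<close> is the slice at \<open>x\<^sub>3 = z\<close>. A pair of functions or constants
  with superscripts \<open>\<plusminus>\<close> is a function on the following type.
\<close>

datatype side = Plus | Minus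

primrec sg :: "side \<Rightarrow> real" where
  "sg Plus = 1"
| "sg Minus = -1"

definition half_line :: "side \<Rightarrow> real set" where
  "half_line s = {z. 0 \<le> sg s * z}"

definition open_half_line :: "side \<Rightarrow> real set" where
  "open_half_line s = {z. 0 < sg s * z}"

definition jump :: "(side \<Rightarrow> real) \<Rightarrow> real" where
  "jump \<phi> = \<phi> Plus - \<phi> Minus"

definition dt :: "(real \<Rightarrow> real \<Rightarrow> real) \<Rightarrow> real \<Rightarrow> real \<Rightarrow> real" where
  "dt u t x = deriv (\<lambda>r. u r x) t"

definition d1 :: "(real \<Rightarrow> real \<Rightarrow> real) \<Rightarrow> real \<Rightarrow> real \<Rightarrow> real" where
  "d1 u t x = deriv (\<lambda>r. u t r) x"

text \<open>The derivative within the closed half line is the ordinary derivative at interior points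
  and the one-sided derivative at \<open>x\<^sub>3 = 0\<close>.\<close>

definition d3 :: "side \<Rightarrow> (real \<Rightarrow> real \<Rightarrow> real \<Rightarrow> real) \<Rightarrow> real \<Rightarrow> real \<Rightarrow> real \<Rightarrow> real" where
  "d3 s \<phi> z t x = vector_derivative (\<lambda>r. \<phi> r t x) (at z within half_line s)"

text \<open>The operator \<open>\<gamma> + \<partial>\<^sub>t + v \<partial>\<^sub>1\<close>.\<close>

definition transport :: "real \<Rightarrow> real \<Rightarrow> (real \<Rightarrow> real \<Rightarrow> real) \<Rightarrow> real \<Rightarrow> real \<Rightarrow> real" where
  "transport \<gamma> v u t x = \<gamma> * u t x + dt u t x + v * d1 u t x"

text \<open>The operator \<open>\<partial>\<^sub>1\<^sub>1 + \<partial>\<^sub>3\<^sub>3\<close>.\<close>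

definition lap13 :: "side \<Rightarrow> (real \<Rightarrow> real \<Rightarrow> real \<Rightarrow> real) \<Rightarrow> real \<Rightarrow> real \<Rightarrow> real \<Rightarrow> real" where
  "lap13 s \<phi> z t x = d1 (d1 (\<phi> z)) t x + d3 s (d3 s \<phi>) z t x"

text \<open>Normalised so that \<open>\<partial>\<^sub>t\<close> and \<open>\<partial>\<^sub>1\<close> become multiplication by \<open>i \<delta>\<close> and \<open>i \<eta>\<close>.\<close>

definition fourier :: "(real \<Rightarrow> real \<Rightarrow> real) \<Rightarrow> real \<Rightarrow> real \<Rightarrow> complex" where
  "fourier u \<delta> \<eta> =
     (\<integral>q. cis (- (\<delta> * fst q + \<eta> * snd q)) * complex_of_real (u (fst q) (snd q)) \<partial>lborel)"

definition integrable2 :: "(real \<Rightarrow> real \<Rightarrow> real) \<Rightarrow> bool" where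
  "integrable2 u \<longleftrightarrow> integrable lborel (\<lambda>q::real \<times> real. u (fst q) (snd q))"

definition partially_differentiable :: "(real \<Rightarrow> real \<Rightarrow> real) \<Rightarrow> bool" where
  "partially_differentiable u \<longleftrightarrow>
     (\<forall>t x. (\<lambda>r. u r x) differentiable (at t) \<and> (\<lambda>r. u t r) differentiable (at x))"

text \<open>Regularity in \<open>(t, x\<^sub>1)\<close>: all partial derivatives of order at most two exist and are
  integrable over the plane, so that they have Fourier transforms.\<close>

definition tangentially_regular :: "(real \<Rightarrow> real \<Rightarrow> real) \<Rightarrow> bool" where
  "tangentially_regular u \<longleftrightarrow>
     partially_differentiable u \<and> partially_differentiable (dt u) \<and> partially_differentiable (d1 u) \<and>
     integrable2 u \<and> integrable2 (dt u) \<and> integrable2 (d1 u) \<and>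
     integrable2 (dt (dt u)) \<and> integrable2 (dt (d1 u)) \<and>
     integrable2 (d1 (dt u)) \<and> integrable2 (d1 (d1 u))"

text \<open>Integrable slices with an integrable majorant that is uniform for \<open>x\<^sub>3\<close> in bounded
  subsets of \<open>Z\<close>; this justifies differentiating the Fourier transform in \<open>x\<^sub>3\<close>.\<close>

definition dominated_slices :: "real set \<Rightarrow> (real \<Rightarrow> real \<Rightarrow> real \<Rightarrow> real) \<Rightarrow> bool" where
  "dominated_slices Z \<phi> \<longleftrightarrow>
     (\<forall>z\<in>Z. integrable2 (\<phi> z)) \<and>
     (\<forall>R. \<exists>G. integrable2 G \<and> (\<forall>z\<in>Z. \<bar>z\<bar> \<le> R \<longrightarrow> (\<forall>t x. \<bar>\<phi> z t x\<bar> \<le> G t x)))"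

text \<open>The regularity required of the bulk unknowns: second order derivatives in the open half
  space, and the trace of the function and of its normal derivative at \<open>x\<^sub>3 = 0\<close>.\<close>

definition bulk_regular :: "side \<Rightarrow> (real \<Rightarrow> real \<Rightarrow> real \<Rightarrow> real) \<Rightarrow> bool" where
  "bulk_regular s \<phi> \<longleftrightarrow>
     (\<forall>z\<in>open_half_line s. tangentially_regular (\<phi> z)) \<and>
     (\<forall>t x. \<forall>z\<in>half_line s. (\<lambda>r. \<phi> r t x) differentiable (at z within half_line s)) \<and>
     (\<forall>t x. continuous_on (half_line s) (\<lambda>r. d3 s \<phi> r t x)) \<and>
     (\<forall>t x. \<forall>z\<in>open_half_line s. (\<lambda>r. d3 s \<phi> r t x) differentiable (at z)) \<and>
     dominated_slices (half_line s) \<phi> \<and>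
     dominated_slices (half_line s) (d3 s \<phi>) \<and>
     dominated_slices (open_half_line s) (d3 s (d3 s \<phi>))"

text \<open>The principal branch is the root with positive real part: for \<open>Re \<tau> > 0\<close> the radicand
  stays off the closed negative real axis, see \<open>Re_mu_pos\<close> below.\<close>

definition mu :: "real \<Rightarrow> real \<Rightarrow> complex \<Rightarrow> real \<Rightarrow> complex" where
  "mu CB v \<tau> \<eta> =
     csqrt ((\<tau> + \<i> * of_real v * of_real \<eta>)\<^sup>2 / (of_real CB)\<^sup>2 + (of_real \<eta>)\<^sup>2)"

lemma Re_mu_pos:
  assumes "Re \<tau> > 0" "CB > 0"
  shows "Re (mu CB v \<tau> \<eta>) > 0"
proof -
  let ?w = "(\<tau> + \<i> * of_real v * of_real \<eta>)\<^sup>2 / (of_real CB)\<^sup>2 + (of_real \<eta>)\<^sup>2"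
  define b where "b = Im \<tau> + v * \<eta>"
  have w: "?w = Complex (((Re \<tau>)\<^sup>2 - b\<^sup>2) / CB\<^sup>2 + \<eta>\<^sup>2) (2 * Re \<tau> * b / CB\<^sup>2)"
  proof -
    have "\<tau> + \<i> * of_real v * of_real \<eta> = Complex (Re \<tau>) b"
      by (simp add: complex_eq_iff b_def)
    moreover have "?w = (\<tau> + \<i> * of_real v * of_real \<eta>)\<^sup>2 / of_real (CB\<^sup>2) + of_real (\<eta>\<^sup>2)"
      by simp
    ultimately show ?thesis
      by (simp only: complex_eq_iff) (simp add: power2_eq_square Re_divide_of_real Im_divide_of_real)
  qed
  have "Im ?w \<noteq> 0 \<or> Re ?w > 0"
  proof (cases "b = 0")
    case True
    then show ?thesis using assms by (simp only: w complex.sel) (auto intro!: add_pos_nonneg)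
  next
    case False
    then show ?thesis using assms by (simp only: w complex.sel) auto
  qed
  moreover have "0 < Re (csqrt z)" if z: "Im z \<noteq> 0 \<or> Re z > 0" for z
  proof (rule ccontr)
    assume "\<not> 0 < Re (csqrt z)"
    then have "Re (csqrt z) = 0"
      using csqrt_principal[of z] by auto
    then have "Im ((csqrt z)\<^sup>2) = 0" "Re ((csqrt z)\<^sup>2) \<le> 0"
      by (simp_all only: power2_eq_square times_complex.sel) auto
    then show False
      using z by (simp only: power2_csqrt) auto
  qed
  ultimately show ?thesis
    unfolding mu_def by blast
qed

text \<open>The imaginary part of \<open>\<tau> = \<gamma> + i \<delta>\<close> is the dual variable \<open>\<delta>\<close>.\<close>

definition source_integrand ::
    "real \<Rightarrow> real \<Rightarrow> side \<Rightarrow> (real \<Rightarrow> real \<Rightarrow> real \<Rightarrow> real) \<Rightarrow> complex \<Rightarrow> real \<Rightarrow> real \<Rightarrow> complex" where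
  "source_integrand CB v s \<phi> \<tau> \<eta> y =
     exp (- mu CB v \<tau> \<eta> * of_real y) * fourier (\<phi> (sg s * y)) (Im \<tau>) \<eta>"

text \<open>With this normalisation the evolution equation for the front contains \<open>CB\<^sup>2 W\<close>: the factor
  \<open>1 / CB\<^sup>2\<close> comes from solving the bulk equation for the second \<open>x\<^sub>3\<close>-derivative, and the front
  equation multiplies the normal derivatives by \<open>c\<^sup>2 + cA\<^sup>2 = CB\<^sup>2\<close>.\<close>

definition W ::
    "real \<Rightarrow> (side \<Rightarrow> real) \<Rightarrow> (side \<Rightarrow> real \<Rightarrow> real \<Rightarrow> real \<Rightarrow> real) \<Rightarrow> complex \<Rightarrow> real \<Rightarrow> complex" where
  "W CB v K \<tau> \<eta> =
     1 / (mu CB (v Plus) \<tau> \<eta> * (of_real CB)\<^sup>2) *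
       (LBINT y:{0<..}. source_integrand CB (v Plus) Plus (K Plus) \<tau> \<eta> y) -
     1 / (mu CB (v Minus) \<tau> \<eta> * (of_real CB)\<^sup>2) *
       (LBINT y:{0<..}. source_integrand CB (v Minus) Minus (K Minus) \<tau> \<eta> y)"

end

theory Submission
  imports Defs
begin

text \<open>
  Write \<open>u^\<close> for the Fourier transform of \<open>u\<close> in \<open>(t, x\<^sub>1)\<close>. The transformed magnetic equation is
  algebraic. With \<open>a = \<tau> + i v \<eta>\<close> it reads \<open>a\<^sup>2 B2^ = B a\<^sup>2 h^\<close>, and \<open>a \<noteq> 0\<close> because \<open>Re a = \<gamma> > 0\<close>. Hence the total
  pressure \<open>Q = c\<^sup>2 h^ + (B / \<rho>) B2^\<close> equals \<open>CB\<^sup>2 h^\<close> inside each half space, and the wave equation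
  becomes the scalar equation \<open>Q'' = \<mu>\<^sup>2 Q - K^\<close> on a half line. Both jump conditions and the front
  equation involve \<open>h\<close> and \<open>B2\<close> only through \<open>Q\<close> and its normal derivative at \<open>x\<^sub>3 = 0\<close>.

  For a solution tending to zero, multiplying \<open>Q' + \<mu> Q\<close> by \<open>exp (- \<mu> y)\<close> and integrating gives
  \<open>Q'(0) + \<mu> Q(0) = \<integral> exp (- \<mu> y) K^(y) dy\<close>, the derivative pointing into the half space
  (\<open>decaying_solution_boundary_identity\<close>). The boundary term at infinity vanishes because \<open>Q\<close>
  and \<open>Q''\<close> are bounded there, which bounds \<open>Q'\<close> by Landau's inequality.

  Write \<open>P\<close> and \<open>M\<close> for the transformed normal derivatives \<open>\<partial>\<^sub>3 Q\<close> at \<open>x\<^sub>3 = 0\<close> on the two sides. The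
  first jump condition says that \<open>Q(0)\<close> is the same on both sides, so it cancels in
  \<open>CB\<^sup>2 W = P / \<mu>\<^sup>+ + M / \<mu>\<^sup>-\<close>. The second jump condition expresses \<open>P - M\<close>, and the front equation
  expresses \<open>P + M\<close>, in terms of the transform of \<open>f\<close>. Eliminating \<open>P\<close> and \<open>M\<close> is the algebra of
  \<open>front_symbol_identity\<close>.

  The analytic part is to make the transformed system meaningful under the stated regularity:
  \<open>fourier_dt\<close> and \<open>fourier_d1\<close> turn tangential derivatives into multipliers, and
  \<open>has_vector_derivative_fourier_slices\<close> exchanges the transform with \<open>\<partial>\<^sub>3\<close> by dominated convergence.
  The second derivatives may be discontinuous, so the fundamental theorem of calculus is used for
  gauge integrals: on a bounded interval it then holds for every continuous function that is
  differentiable in the interior.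
\<close>

section \<open>Integrals of derivatives over unbounded intervals\<close>

text \<open>The derivative \<open>f\<close> exists pointwise and may be discontinuous. The gauge integral gives
  \<open>F R - F a\<close> over each bounded interval, and Lebesgue integrability of \<open>f\<close> lets \<open>R\<close> tend to infinity.\<close>

lemma tendsto_at_top_FTC:
  fixes F f :: "real \<Rightarrow> complex"
  assumes cont: "continuous_on {a..} F"
    and der: "\<And>x. a < x \<Longrightarrow> (F has_vector_derivative f x) (at x)"
    and int: "set_integrable lborel {a<..} f"
  shows "(F \<longlongrightarrow> F a + (LBINT x:{a<..}. f x)) at_top"
proof -
  have lim: "((\<lambda>R. \<integral>x. indicator {..R} x *\<^sub>R (indicator {a<..} x *\<^sub>R f x) \<partial>lborel)
      \<longlongrightarrow> (LBINT x:{a<..}. f x)) at_top"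
    using tendsto_integral_at_top[OF _ int[unfolded set_integrable_def]]
    by (simp add: set_lebesgue_integral_def)
  have val: "F a + (\<integral>x. indicator {..R} x *\<^sub>R (indicator {a<..} x *\<^sub>R f x) \<partial>lborel) = F R"
    if "a \<le> R" for R
  proof -
    have sub: "set_integrable lborel {a<..R} f"
      by (rule set_integrable_subset[OF int]) auto
    have "(f has_integral (F R - F a)) {a..R}"
      using that by (intro fundamental_theorem_of_calculus_interior
          continuous_on_subset[OF cont] der) auto
    moreover have "negligible {x \<in> {a..R} - {a<..R}. f x \<noteq> 0}"
      by (rule negligible_subset[of "{a}"]) auto
    moreover have "negligible {x \<in> {a<..R} - {a..R}. f x \<noteq> 0}"
      by (rule negligible_subset[of "{}"]) auto
    ultimately have "(f has_integral (F R - F a)) {a<..R}"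
      using has_integral_spike_set_eq by blast
    then have "(LBINT x:{a<..R}. f x) = F R - F a"
      using set_borel_integral_eq_integral[OF sub] by (simp add: integral_unique)
    moreover have "(\<integral>x. indicator {..R} x *\<^sub>R (indicator {a<..} x *\<^sub>R f x) \<partial>lborel)
        = (LBINT x:{a<..R}. f x)"
      unfolding set_lebesgue_integral_def
      by (intro Bochner_Integration.integral_cong) (auto simp: indicator_def)
    ultimately show ?thesis by simp
  qed
  show ?thesis
    by (rule Lim_transform_eventually[OF tendsto_add[OF tendsto_const lim]])
      (rule eventually_mono[OF eventually_ge_at_top[of a] val])
qed

lemma integrable_tendsto_at_top_imp_zero:
  fixes F :: "real \<Rightarrow> complex"
  assumes lim: "(F \<longlongrightarrow> L) at_top" and int: "set_integrable lborel {a<..} F"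
  shows "L = 0"
proof (rule ccontr)
  assume "L \<noteq> 0"
  then have L: "norm L > 0" by simp
  have "eventually (\<lambda>x. norm L / 2 < norm (F x)) at_top"
    using tendsto_norm[OF lim] L by (intro order_tendstoD(1)[where y = "norm L"]) auto
  then obtain R where R: "\<And>x. x \<ge> R \<Longrightarrow> norm L / 2 < norm (F x)"
    by (auto simp: eventually_at_top_linorder)
  define b where "b = max R a"
  have "set_integrable lborel {b<..} (\<lambda>x. norm L / 2)"
    unfolding set_integrable_def
  proof (rule Bochner_Integration.integrable_bound[OF int[unfolded set_integrable_def]])
    show "AE x in lborel. norm (indicat_real {b<..} x *\<^sub>R (norm L / 2))
        \<le> norm (indicat_real {a<..} x *\<^sub>R F x)"
      using R by (auto simp: indicator_def b_def intro!: AE_I2 less_imp_le)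
  qed simp
  then have "integrable lborel (\<lambda>x. (2 / norm L) * (indicat_real {b<..} x *\<^sub>R (norm L / 2)))"
    unfolding set_integrable_def by (rule integrable_mult_right)
  then have "integrable lborel (indicat_real {b<..})"
    using L by (simp add: mult.commute)
  then have fin: "emeasure lborel {b<..} < \<infinity>"
    by (simp add: integrable_indicator_iff)
  have "ennreal (real n) \<le> emeasure lborel {b<..}" for n
  proof -
    have "emeasure lborel {b<..b + real n} \<le> emeasure lborel {b<..}"
      by (rule emeasure_mono) auto
    then show ?thesis by simp
  qed
  moreover obtain n where "emeasure lborel {b<..} < ennreal (real n)"
    using fin ennreal_Ex_less_of_nat by (auto simp: ennreal_of_nat_eq_real_of_nat)
  ultimately show False
    by (meson leD)
qed

lemma integral_derivative_half_line:
  fixes F f :: "real \<Rightarrow> complex"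
  assumes cont: "continuous_on {a..} F"
    and der: "\<And>x. a < x \<Longrightarrow> (F has_vector_derivative f x) (at x)"
    and int: "set_integrable lborel {a<..} f"
    and int_F: "set_integrable lborel {a<..} F"
  shows "(LBINT x:{a<..}. f x) = - F a"
  using minus_unique[OF integrable_tendsto_at_top_imp_zero[OF tendsto_at_top_FTC[OF cont der int] int_F]]
  by simp

text \<open>Integration by parts without boundary terms. Both halves of the line contribute \<open>F 0\<close>, with
  opposite signs; the negative half is reflected onto the positive one.\<close>

lemma integral_derivative_real_line:
  fixes F f :: "real \<Rightarrow> complex"
  assumes der: "\<And>x. (F has_vector_derivative f x) (at x)"
    and int: "integrable lborel f" and int_F: "integrable lborel F"
  shows "(\<integral>x. f x \<partial>lborel) = 0"
proof -
  have half: "set_integrable lborel {0<..} g" if "integrable lborel g" for g :: "real \<Rightarrow> complex"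
    using integrable_mult_indicator[OF _ that, of "{0<..}"] by (simp add: set_integrable_def)
  have refl: "integrable lborel (\<lambda>x. g (- x))" if "integrable lborel g" for g :: "real \<Rightarrow> complex"
    using lborel_integrable_real_affine[OF that, of "-1" 0] by simp
  have cont: "continuous_on A F" for A
    using der by (meson continuous_at_imp_continuous_on has_vector_derivative_continuous)
  have pos: "(LBINT x:{0<..}. f x) = - F 0"
    by (rule integral_derivative_half_line) (auto intro!: cont der half int int_F)
  have "(LBINT x:{0<..}. - f (- x)) = - F (- 0)"
  proof (rule integral_derivative_half_line)
    show "continuous_on {0..} (\<lambda>x. F (- x))"
      by (intro continuous_on_compose2[OF cont] continuous_intros) auto
    show "((\<lambda>x. F (- x)) has_vector_derivative - f (- x)) (at x)" for x
    proof -
      have "(uminus has_vector_derivative - 1) (at x)"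
        by (auto intro!: derivative_eq_intros)
      from vector_diff_chain_at[OF this der[of "- x"]] show ?thesis
        by (simp add: o_def)
    qed
    show "set_integrable lborel {0<..} (\<lambda>x. - f (- x))"
      by (intro half integrable_minus refl int)
    show "set_integrable lborel {0<..} (\<lambda>x. F (- x))"
      by (intro half refl int_F)
  qed
  then have neg: "(\<integral>x. indicator {0<..} x *\<^sub>R f (- x) \<partial>lborel) = F 0"
    by (simp add: set_lebesgue_integral_def)
  have "(\<integral>x. indicator {..<0} x *\<^sub>R f x \<partial>lborel)
      = (\<integral>x. indicator {..<0} (- x) *\<^sub>R f (- x) \<partial>lborel)"
    using lborel_integral_real_affine[of "-1" "\<lambda>x. indicat_real {..<0} x *\<^sub>R f x" 0] by simp
  also have "\<dots> = (\<integral>x. indicator {0<..} x *\<^sub>R f (- x) \<partial>lborel)"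
    by (intro Bochner_Integration.integral_cong) (auto simp: indicator_def)
  finally have neg': "(\<integral>x. indicator {..<0} x *\<^sub>R f x \<partial>lborel) = F 0"
    using neg by simp
  have "(\<integral>x. f x \<partial>lborel)
      = (\<integral>x. indicator {..<0} x *\<^sub>R f x + indicator {0<..} x *\<^sub>R f x \<partial>lborel)"
  proof (rule integral_cong_AE)
    show "AE x in lborel. f x = indicator {..<0} x *\<^sub>R f x + indicator {0<..} x *\<^sub>R f x"
      using AE_lborel_singleton[of 0]
      by eventually_elim (auto simp: indicator_def)
  qed (use borel_measurable_integrable[OF int] in auto)
  also have "\<dots> = F 0 + (LBINT x:{0<..}. f x)"
    unfolding set_lebesgue_integral_def neg'[symmetric]
    by (intro Bochner_Integration.integral_add integrable_mult_indicator int) auto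
  finally show ?thesis using pos by simp
qed

section \<open>Decaying solutions of a second order equation on a half line\<close>

text \<open>A form of Landau's inequality. By the mean value inequality for \<open>g1\<close>, the increment
  \<open>g (y + 1) - g y\<close> differs from \<open>g1 y\<close> by at most \<open>N\<close>.\<close>

lemma bounded_of_bounded_second_derivative:
  fixes g g1 g2 :: "real \<Rightarrow> complex"
  assumes der: "\<And>y. a \<le> y \<Longrightarrow> (g has_vector_derivative g1 y) (at y)"
    and der1: "\<And>y. a \<le> y \<Longrightarrow> (g1 has_vector_derivative g2 y) (at y)"
    and b: "\<And>y. a \<le> y \<Longrightarrow> norm (g y) \<le> M" and b2: "\<And>y. a \<le> y \<Longrightarrow> norm (g2 y) \<le> N"
    and y: "a \<le> y"
  shows "norm (g1 y) \<le> 2 * M + N"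
proof -
  have N: "0 \<le> N" by (rule order_trans[OF norm_ge_zero b2[OF y]])
  have "norm (g1 z - g1 y) \<le> N" if z: "z \<in> {y..y+1}" for z
  proof -
    have "norm (g1 z - g1 y) \<le> N * norm (z - y)"
    proof (rule differentiable_bound[where S = "{y..y+1}" and f' = "\<lambda>x h. h *\<^sub>R g2 x"])
      fix x assume "x \<in> {y..y+1}"
      then have x: "a \<le> x" using y by auto
      show "(g1 has_derivative (\<lambda>h. h *\<^sub>R g2 x)) (at x within {y..y+1})"
        using has_vector_derivative_at_within[OF der1[OF x]] by (simp add: has_vector_derivative_def)
      show "onorm (\<lambda>h. h *\<^sub>R g2 x) \<le> N"
      proof (rule onorm_le)
        show "norm (h *\<^sub>R g2 x) \<le> N * norm h" for h
          using mult_left_mono[OF b2[OF x], of "\<bar>h\<bar>"] by (simp add: mult.commute)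
      qed
    qed (use z in auto)
    also have "\<dots> \<le> N * 1" using z N by (intro mult_left_mono) auto
    finally show ?thesis by simp
  qed
  then have "norm (g (y+1) - g y - (y + 1 - y) *\<^sub>R g1 y) \<le> norm (y + 1 - y) * N"
  proof (intro vector_differentiable_bound_linearization[where S = "{y..y+1}"])
    show "(g has_vector_derivative g1 z) (at z within {y..y+1})" if "z \<in> {y..y+1}" for z
      by (rule has_vector_derivative_at_within, rule der) (use that y in auto)
  qed (auto simp: closed_segment_eq_real_ivl)
  then have "norm (g (y+1) - g y - g1 y) \<le> N" by simp
  then have "norm (g1 y) \<le> norm (g (y+1)) + norm (g y) + N"
    using norm_triangle_ineq4[of "g (y+1) - g y" "g (y+1) - g y - g1 y"]
      norm_triangle_ineq4[of "g (y+1)" "g y"] by simp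
  also have "\<dots> \<le> M + M + N" using y by (intro add_mono b) auto
  finally show ?thesis by simp
qed

lemma has_vector_derivative_within_iff_slope:
  fixes f :: "real \<Rightarrow> 'a::real_normed_vector"
  shows "(f has_vector_derivative D) (at x within S)
    \<longleftrightarrow> ((\<lambda>y. inverse (y - x) *\<^sub>R (f y - f x)) \<longlongrightarrow> D) (at x within S)"
proof -
  have "norm (f y - f x - (y - x) *\<^sub>R D) / norm (y - x)
      = norm (inverse (y - x) *\<^sub>R (f y - f x) - D)" if "y \<noteq> x" for y
  proof -
    have "inverse (y - x) *\<^sub>R (f y - f x) - D = inverse (y - x) *\<^sub>R (f y - f x - (y - x) *\<^sub>R D)"
      using that by (simp add: scaleR_diff_right)
    then show ?thesis by (simp add: divide_inverse mult.commute)
  qed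
  then have "((\<lambda>y. norm (f y - f x - (y - x) *\<^sub>R D) / norm (y - x)) \<longlongrightarrow> 0) (at x within S)
      \<longleftrightarrow> ((\<lambda>y. norm (inverse (y - x) *\<^sub>R (f y - f x) - D)) \<longlongrightarrow> 0) (at x within S)"
    by (intro tendsto_cong) (auto simp: eventually_at_filter)
  also have "\<dots> \<longleftrightarrow> ((\<lambda>y. inverse (y - x) *\<^sub>R (f y - f x)) \<longlongrightarrow> D) (at x within S)"
    by (simp add: tendsto_norm_zero_iff LIM_zero_iff)
  finally show ?thesis
    by (simp add: has_vector_derivative_def has_derivative_iff_norm bounded_linear_scaleR_left)
qed

text \<open>A derivative is a pointwise limit of difference quotients. Right difference quotients keep the
  evaluation points inside the half line.\<close>

lemma borel_measurable_derivative_half_line: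
  fixes g g1 :: "real \<Rightarrow> complex"
  assumes der: "\<And>y. 0 < y \<Longrightarrow> (g has_vector_derivative g1 y) (at y)"
  shows "(\<lambda>y. indicator {0<..} y *\<^sub>R g1 y) \<in> borel_measurable borel"
proof (rule borel_measurable_LIMSEQ_metric)
  have cont: "continuous_on {0<..} g"
    using der by (meson continuous_at_imp_continuous_on greaterThan_iff
        has_vector_derivative_continuous)
  fix n :: nat
  show "(\<lambda>y. indicator {0<..} y *\<^sub>R (real (Suc n) *\<^sub>R (g (y + inverse (real (Suc n))) - g y)))
      \<in> borel_measurable borel"
    by (intro borel_measurable_continuous_on_indicator continuous_intros
        continuous_on_compose2[OF cont]) (auto intro: add_pos_pos)
next
  fix y :: real
  show "(\<lambda>n. indicator {0<..} y *\<^sub>R (real (Suc n) *\<^sub>R (g (y + inverse (real (Suc n))) - g y)))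
      \<longlonglongrightarrow> indicator {0<..} y *\<^sub>R g1 y"
  proof (cases "y > 0")
    case True
    have "filterlim (\<lambda>n. y + inverse (real (Suc n))) (at y) sequentially"
      using LIMSEQ_inverse_real_of_nat_add[of y] by (auto simp: filterlim_at)
    from filterlim_compose[OF der[OF True, unfolded has_vector_derivative_within_iff_slope] this]
    have "(\<lambda>n. real (Suc n) *\<^sub>R (g (y + inverse (real (Suc n))) - g y)) \<longlonglongrightarrow> g1 y"
      by simp
    then show ?thesis using True by simp
  qed simp
qed

lemma integrable_exp_decay_half_line:
  fixes k :: "real \<Rightarrow> complex"
  assumes meas: "(\<lambda>y. indicator {0<..} y *\<^sub>R k y) \<in> borel_measurable borel"
    and bound: "\<And>y. 0 < y \<Longrightarrow> norm (k y) \<le> C" and \<mu>: "Re \<mu> > 0"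
  shows "set_integrable lborel {0<..} (\<lambda>y. exp (- \<mu> * of_real y) * k y)"
proof -
  have "(\<lambda>y. exp (- Re \<mu> * y)) absolutely_integrable_on {0..}"
    using \<mu> by (intro nonnegative_absolutely_integrable_1 integrable_on_exp_minus_to_infinity) auto
  then have "integrable lebesgue (\<lambda>y. indicator {0..} y *\<^sub>R exp (- Re \<mu> * y))"
    by (simp add: set_integrable_def)
  then have "integrable lborel (\<lambda>y. indicator {0..} y *\<^sub>R exp (- Re \<mu> * y))"
    by (subst (asm) integrable_completion)
      (auto intro!: borel_measurable_continuous_on_indicator continuous_intros)
  then have dom: "integrable lborel (\<lambda>y. C * (indicator {0..} y *\<^sub>R exp (- Re \<mu> * y)))"
    by (rule integrable_mult_right)
  show ?thesis
    unfolding set_integrable_def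
  proof (rule Bochner_Integration.integrable_bound[OF dom])
    have "(\<lambda>y. exp (- \<mu> * of_real y) * (indicator {0<..} y *\<^sub>R k y)) \<in> borel_measurable borel"
      by (intro borel_measurable_times meas borel_measurable_continuous_onI continuous_intros)
    then show "(\<lambda>y. indicator {0<..} y *\<^sub>R (exp (- \<mu> * of_real y) * k y)) \<in> borel_measurable lborel"
      by (simp add: mult.commute)
    have "norm (exp (- \<mu> * of_real y) * k y) \<le> \<bar>C\<bar> * exp (- Re \<mu> * y)" if "y > 0" for y
      using bound[OF that] by (auto simp: norm_mult mult.commute[of "exp _"] intro!: mult_right_mono)
    then show "AE y in lborel. norm (indicator {0<..} y *\<^sub>R (exp (- \<mu> * of_real y) * k y))
        \<le> norm (C * (indicator {0..} y *\<^sub>R exp (- Re \<mu> * y)))"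
      by (intro AE_I2) (auto simp: indicator_def abs_mult)
  qed
qed

text \<open>For \<open>w = g1 + \<mu> g\<close> the equation is \<open>w' = \<mu> w - k\<close>, so \<open>exp (- \<mu> y) w\<close> has the derivative
  \<open>- exp (- \<mu> y) k\<close>. Integration yields the identity once \<open>w\<close> is known to be bounded at infinity.
  Measurability of \<open>k\<close> is a consequence of the equation.\<close>

lemma decaying_solution_boundary_identity:
  fixes g g1 k :: "real \<Rightarrow> complex"
  assumes \<mu>: "Re \<mu> > 0"
    and der: "\<And>y. 0 \<le> y \<Longrightarrow> (g has_vector_derivative g1 y) (at y within {0..})"
    and cont1: "continuous_on {0..} g1"
    and der1: "\<And>y. 0 < y \<Longrightarrow> (g1 has_vector_derivative \<mu>\<^sup>2 * g y - k y) (at y)"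
    and g_decay: "(g \<longlongrightarrow> 0) at_top" and k_decay: "(k \<longlongrightarrow> 0) at_top"
    and k_bound: "\<And>R. \<exists>C. \<forall>y. 0 < y \<and> y \<le> R \<longrightarrow> norm (k y) \<le> C"
  shows "set_integrable lborel {0<..} (\<lambda>y. exp (- \<mu> * of_real y) * k y)"
    and "(LBINT y:{0<..}. exp (- \<mu> * of_real y) * k y) = g1 0 + \<mu> * g 0"
proof -
  have der': "(g has_vector_derivative g1 y) (at y)" if "0 < y" for y
    using der[of y] that at_within_interior[of y "{0..}"] by simp
  have cont: "continuous_on {0..} g"
    using der by (meson atLeast_iff continuous_on_eq_continuous_within has_vector_derivative_continuous)
  have "eventually (\<lambda>y. norm (g y) < 1 \<and> norm (k y) < 1) at_top"
    using tendstoD[OF g_decay, of 1] tendstoD[OF k_decay, of 1]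
    by (auto simp: eventually_conj_iff)
  then obtain R' where R': "\<And>y. y \<ge> R' \<Longrightarrow> norm (g y) < 1 \<and> norm (k y) < 1"
    by (auto simp: eventually_at_top_linorder)
  define R where "R = max R' 1"
  have R: "R > 0" "\<And>y. y \<ge> R \<Longrightarrow> norm (g y) \<le> 1" "\<And>y. y \<ge> R \<Longrightarrow> norm (k y) \<le> 1"
    using R' by (auto simp: R_def intro: less_imp_le)
  \<comment> \<open>Together with the decay beyond \<open>R\<close> this bounds \<open>k\<close> on the whole half line.\<close>
  obtain C where C: "\<And>y. 0 < y \<Longrightarrow> y \<le> R \<Longrightarrow> norm (k y) \<le> C"
    using k_bound[of R] by blast
  have kC: "norm (k y) \<le> max C 1" if "0 < y" for y
    using C[OF that] R(3)[of y] by (cases "y \<le> R") auto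
  \<comment> \<open>\<open>k\<close> is the difference of the continuous \<open>\<mu>\<^sup>2 g\<close> and the derivative of \<open>g1\<close>.\<close>
  have "(\<lambda>y. indicator {0<..} y *\<^sub>R (\<mu>\<^sup>2 * g y)) \<in> borel_measurable borel"
    by (intro borel_measurable_continuous_on_indicator continuous_intros
        continuous_on_subset[OF cont]) auto
  from borel_measurable_diff[OF this borel_measurable_derivative_half_line[OF der1]]
  have meas: "(\<lambda>y. indicator {0<..} y *\<^sub>R k y) \<in> borel_measurable borel"
    by (simp add: scaleR_diff_right[symmetric])
  show int: "set_integrable lborel {0<..} (\<lambda>y. exp (- \<mu> * of_real y) * k y)"
    by (rule integrable_exp_decay_half_line[OF meas kC \<mu>])
  define u where "u y = exp (- \<mu> * of_real y) * (g1 y + \<mu> * g y)" for y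
  have "norm (g1 y) \<le> 2 * 1 + (norm \<mu> ^ 2 + 1)" if "R \<le> y" for y
  proof (rule bounded_of_bounded_second_derivative[where a = R])
    fix y assume y: "R \<le> y"
    have "norm (\<mu>\<^sup>2 * g y - k y) \<le> norm \<mu> ^ 2 * norm (g y) + norm (k y)"
      by (metis norm_mult norm_power norm_triangle_ineq4)
    also have "\<dots> \<le> norm \<mu> ^ 2 * 1 + 1"
      using R(2,3)[OF y] by (intro add_mono mult_left_mono) auto
    finally show "norm (\<mu>\<^sup>2 * g y - k y) \<le> norm \<mu> ^ 2 + 1" by simp
  qed (use R that in \<open>auto intro: der' der1\<close>)
  then have g1_bound: "norm (g1 y + \<mu> * g y) \<le> (2 * 1 + (norm \<mu> ^ 2 + 1)) + norm \<mu> * 1" if "R \<le> y" for y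
    using that mult_left_mono[OF R(2)[OF that], of "norm \<mu>"]
    by (intro norm_triangle_mono) (auto simp: norm_mult)
  have exp0: "((\<lambda>y. exp (- Re \<mu> * y)) \<longlongrightarrow> 0) at_top"
    using \<mu> by (intro filterlim_compose[OF exp_at_bot]
        filterlim_tendsto_neg_mult_at_bot[OF tendsto_const] filterlim_ident) auto
  \<comment> \<open>Beyond \<open>R\<close> the factor \<open>g1 + \<mu> g\<close> stays bounded.\<close>
  have u0: "(u \<longlongrightarrow> 0) at_top"
  proof (rule Lim_null_comparison)
    show "eventually (\<lambda>y. norm (u y) \<le> exp (- Re \<mu> * y) * ((2 * 1 + (norm \<mu> ^ 2 + 1)) + norm \<mu> * 1)) at_top"
      using eventually_ge_at_top[of R]
      by eventually_elim (use g1_bound in \<open>auto simp: u_def norm_mult intro!: mult_left_mono\<close>)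
    show "((\<lambda>y. exp (- Re \<mu> * y) * ((2 * 1 + (norm \<mu> ^ 2 + 1)) + norm \<mu> * 1)) \<longlongrightarrow> 0) at_top"
      using tendsto_mult_left_zero[OF exp0] by blast
  qed
  have der_exp: "((\<lambda>y. exp (- \<mu> * of_real y)) has_vector_derivative
      - \<mu> * exp (- \<mu> * of_real y)) (at y)" for y
    by (rule has_vector_derivative_real_field) (auto intro!: derivative_eq_intros)
  have "(u \<longlongrightarrow> u 0 + (LBINT y:{0<..}. - (exp (- \<mu> * of_real y) * k y))) at_top"
  proof (rule tendsto_at_top_FTC)
    show "continuous_on {0..} u"
      unfolding u_def by (intro continuous_intros cont cont1)
    show "(u has_vector_derivative - (exp (- \<mu> * of_real y) * k y)) (at y)" if "0 < y" for y
    proof -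
      have "((\<lambda>y. g1 y + \<mu> * g y) has_vector_derivative (\<mu>\<^sup>2 * g y - k y) + \<mu> * g1 y) (at y)"
        by (intro has_vector_derivative_add has_vector_derivative_mult_right der1 der' that)
      from has_vector_derivative_mult[OF der_exp this] show ?thesis
        unfolding u_def by (simp add: algebra_simps power2_eq_square)
    qed
    show "set_integrable lborel {0<..} (\<lambda>y. - (exp (- \<mu> * of_real y) * k y))"
      using int by (simp add: set_integrable_def)
  qed
  from tendsto_unique[OF _ this u0]
  have "u 0 - (LBINT y:{0<..}. exp (- \<mu> * of_real y) * k y) = 0"
    by (simp add: set_lebesgue_integral_def)
  then show "(LBINT y:{0<..}. exp (- \<mu> * of_real y) * k y) = g1 0 + \<mu> * g 0"
    by (simp add: u_def)
qed

section \<open>The Fourier transform of tangential derivatives\<close>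

abbreviation phase :: "real \<Rightarrow> real \<Rightarrow> real \<times> real \<Rightarrow> complex" where
  "phase \<delta> \<eta> q \<equiv> cis (- (\<delta> * fst q + \<eta> * snd q))"

lemma borel_measurable_phase: "phase \<delta> \<eta> \<in> borel_measurable borel"
  unfolding cis_conv_exp by (intro borel_measurable_continuous_onI continuous_intros)

lemma integrable_phase_mult:
  assumes "integrable2 u"
  shows "integrable lborel (\<lambda>q. phase \<delta> \<eta> q * complex_of_real (u (fst q) (snd q)))"
proof (rule Bochner_Integration.integrable_bound[OF assms[unfolded integrable2_def]])
  show "(\<lambda>q. phase \<delta> \<eta> q * complex_of_real (u (fst q) (snd q))) \<in> borel_measurable lborel"
    using borel_measurable_phase[of \<delta> \<eta>] borel_measurable_integrable[OF assms[unfolded integrable2_def]]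
    by simp
qed (simp add: norm_mult)

lemma integrable2_add: "integrable2 u \<Longrightarrow> integrable2 w \<Longrightarrow> integrable2 (\<lambda>t x. u t x + w t x)"
  and integrable2_diff: "integrable2 u \<Longrightarrow> integrable2 w \<Longrightarrow> integrable2 (\<lambda>t x. u t x - w t x)"
  and integrable2_scale: "integrable2 u \<Longrightarrow> integrable2 (\<lambda>t x. a * u t x)"
  unfolding integrable2_def by auto

lemma fourier_add:
  assumes "integrable2 u" "integrable2 w"
  shows "fourier (\<lambda>t x. u t x + w t x) \<delta> \<eta> = fourier u \<delta> \<eta> + fourier w \<delta> \<eta>"
  unfolding fourier_def
  using Bochner_Integration.integral_add[OF integrable_phase_mult[OF assms(1)] integrable_phase_mult[OF assms(2)]]
  by (simp add: distrib_left)

lemma fourier_scale: "fourier (\<lambda>t x. a * u t x) \<delta> \<eta> = of_real a * fourier u \<delta> \<eta>"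
proof -
  have "fourier (\<lambda>t x. a * u t x) \<delta> \<eta>
      = (\<integral>q. of_real a * (phase \<delta> \<eta> q * complex_of_real (u (fst q) (snd q))) \<partial>lborel)"
    unfolding fourier_def by (simp add: mult_ac)
  then show ?thesis
    unfolding fourier_def integral_mult_right_zero .
qed

lemma fourier_diff:
  assumes "integrable2 u" "integrable2 w"
  shows "fourier (\<lambda>t x. u t x - w t x) \<delta> \<eta> = fourier u \<delta> \<eta> - fourier w \<delta> \<eta>"
  using fourier_add[OF assms(1) integrable2_scale[OF assms(2), of "-1"], of \<delta> \<eta>]
    fourier_scale[of "-1" w \<delta> \<eta>] by simp

lemma fourier_zero: "fourier (\<lambda>t x. 0) \<delta> \<eta> = 0"
  by (simp add: fourier_def)

lemma norm_fourier_le: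
  assumes u: "integrable2 u" and G: "integrable2 G" and le: "\<And>t x. \<bar>u t x\<bar> \<le> G t x"
  shows "norm (fourier u \<delta> \<eta>) \<le> (\<integral>q. G (fst q) (snd q) \<partial>lborel)"
  unfolding fourier_def
proof (rule order_trans[OF integral_norm_bound integral_mono])
  show "integrable lborel (\<lambda>q. norm (phase \<delta> \<eta> q * complex_of_real (u (fst q) (snd q))))"
    by (intro integrable_norm integrable_phase_mult[OF u])
  show "integrable lborel (\<lambda>q. G (fst q) (snd q))"
    using G by (simp add: integrable2_def)
qed (use le in \<open>simp add: norm_mult\<close>)

lemma integrable2_swap:
  assumes "integrable2 u" shows "integrable2 (\<lambda>x t. u t x)"
  using lborel_pair.integrable_product_swap[of "\<lambda>q. u (fst q) (snd q)"] assms
  by (simp add: integrable2_def lborel_prod case_prod_beta')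

lemma fourier_swap:
  assumes "integrable2 u"
  shows "fourier (\<lambda>x t. u t x) \<eta> \<delta> = fourier u \<delta> \<eta>"
proof -
  have "(\<integral>(x, t). phase \<delta> \<eta> (t, x) * complex_of_real (u (fst (t, x)) (snd (t, x)))
         \<partial>(lborel \<Otimes>\<^sub>M lborel)) = fourier u \<delta> \<eta>"
    unfolding fourier_def lborel_prod[symmetric]
    using borel_measurable_integrable[OF integrable_phase_mult[OF assms, of \<delta> \<eta>]]
    by (intro lborel_pair.integral_product_swap) (simp add: lborel_prod)
  then show ?thesis
    unfolding fourier_def lborel_prod[symmetric] by (simp add: case_prod_beta' add.commute)
qed

text \<open>For almost every \<open>x\<close> both \<open>u\<close> and \<open>dt u\<close> are integrable in \<open>t\<close>, so the \<open>t\<close>-derivative \<open>G\<close> of the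
  integrand \<open>F\<close> of the Fourier transform has vanishing integral along that line. Fubini's theorem
  gives that \<open>G\<close> has vanishing integral over the plane.\<close>

lemma fourier_dt:
  assumes diff: "\<And>t x. (\<lambda>r. u r x) differentiable (at t)"
    and u: "integrable2 u" and du: "integrable2 (dt u)"
  shows "fourier (dt u) \<delta> \<eta> = \<i> * of_real \<delta> * fourier u \<delta> \<eta>"
proof -
  define F where "F t x = phase \<delta> \<eta> (t, x) * complex_of_real (u t x)" for t x
  define G where "G t x = phase \<delta> \<eta> (t, x) * complex_of_real (dt u t x) - \<i> * of_real \<delta> * F t x" for t x
  have Fint: "integrable (lborel \<Otimes>\<^sub>M lborel) (case_prod F)"
    using integrable_phase_mult[OF u, of \<delta> \<eta>] by (simp add: F_def lborel_prod case_prod_beta')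
  have Gint: "integrable (lborel \<Otimes>\<^sub>M lborel) (case_prod G)"
    using Bochner_Integration.integrable_diff[OF integrable_phase_mult[OF du, of \<delta> \<eta>]
        integrable_mult_right[OF integrable_phase_mult[OF u, of \<delta> \<eta>], of "\<i> * of_real \<delta>"]]
    by (simp add: F_def G_def lborel_prod case_prod_beta')
  have der: "((\<lambda>t. F t x) has_vector_derivative G t x) (at t)" for t x
  proof -
    have "((\<lambda>r. u r x) has_real_derivative dt u t x) (at t)"
      using diff[of x t] by (simp add: dt_def DERIV_deriv_iff_real_differentiable)
    then have du: "((\<lambda>r. complex_of_real (u r x)) has_vector_derivative of_real (dt u t x)) (at t)"
      by (rule has_vector_derivative_of_real)
    have dp: "((\<lambda>r. exp (\<i> * - (of_real \<delta> * of_real r + of_real (\<eta> * x)))) has_vector_derivative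
        - \<i> * of_real \<delta> * exp (\<i> * - (of_real \<delta> * of_real t + of_real (\<eta> * x)))) (at t)"
      by (rule has_vector_derivative_real_field) (auto intro!: derivative_eq_intros)
    show ?thesis
      using has_vector_derivative_mult[OF dp du]
      by (simp add: F_def G_def cis_conv_exp algebra_simps)
  qed
  have "AE x in lborel. (\<integral>t. G t x \<partial>lborel) = 0"
    using lborel_pair.AE_integrable_snd[OF Fint] lborel_pair.AE_integrable_snd[OF Gint]
    by eventually_elim (rule integral_derivative_real_line[OF der])
  then have "(\<integral>x. (\<integral>t. G t x \<partial>lborel) \<partial>lborel) = 0"
    by (rule integral_eq_zero_AE)
  then have "(\<integral>q. case_prod G q \<partial>lborel) = 0"
    using lborel_pair.integral_snd[OF Gint] by (simp add: lborel_prod)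
  moreover have "(\<integral>q. case_prod G q \<partial>lborel) = fourier (dt u) \<delta> \<eta> - \<i> * of_real \<delta> * fourier u \<delta> \<eta>"
    using Bochner_Integration.integral_diff[OF integrable_phase_mult[OF du, of \<delta> \<eta>]
        integrable_mult_right[OF integrable_phase_mult[OF u, of \<delta> \<eta>], of "\<i> * of_real \<delta>"]]
    by (simp add: fourier_def F_def G_def case_prod_beta')
  ultimately show ?thesis by simp
qed

lemma fourier_d1:
  assumes diff: "\<And>t x. (\<lambda>r. u t r) differentiable (at x)"
    and u: "integrable2 u" and du: "integrable2 (d1 u)"
  shows "fourier (d1 u) \<delta> \<eta> = \<i> * of_real \<eta> * fourier u \<delta> \<eta>"
proof -
  have eq: "(\<lambda>x t. d1 u t x) = dt (\<lambda>x t. u t x)"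
    by (simp add: dt_def d1_def fun_eq_iff)
  have "fourier (dt (\<lambda>x t. u t x)) \<eta> \<delta> = \<i> * of_real \<eta> * fourier (\<lambda>x t. u t x) \<eta> \<delta>"
    using integrable2_swap[OF du] by (intro fourier_dt diff integrable2_swap[OF u]) (simp add: eq)
  then show ?thesis
    using fourier_swap[OF u] fourier_swap[OF du] by (simp add: eq)
qed

lemma fourier_tangential_derivatives:
  assumes "tangentially_regular u"
  shows "fourier (dt u) \<delta> \<eta> = \<i> * of_real \<delta> * fourier u \<delta> \<eta>"
    and "fourier (d1 u) \<delta> \<eta> = \<i> * of_real \<eta> * fourier u \<delta> \<eta>"
    and "fourier (dt (dt u)) \<delta> \<eta> = (\<i> * of_real \<delta>)\<^sup>2 * fourier u \<delta> \<eta>"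
    and "fourier (d1 (dt u)) \<delta> \<eta> = \<i> * of_real \<eta> * (\<i> * of_real \<delta>) * fourier u \<delta> \<eta>"
    and "fourier (dt (d1 u)) \<delta> \<eta> = \<i> * of_real \<eta> * (\<i> * of_real \<delta>) * fourier u \<delta> \<eta>"
    and "fourier (d1 (d1 u)) \<delta> \<eta> = (\<i> * of_real \<eta>)\<^sup>2 * fourier u \<delta> \<eta>"
  using assms unfolding tangentially_regular_def partially_differentiable_def
  by (simp_all add: fourier_dt fourier_d1 power2_eq_square)

lemma dt_d1_linear_combination:
  assumes "partially_differentiable u" "partially_differentiable w" "partially_differentiable y"
  shows "dt (\<lambda>t x. a * u t x + w t x + b * y t x) t x = a * dt u t x + dt w t x + b * dt y t x"
    and "d1 (\<lambda>t x. a * u t x + w t x + b * y t x) t x = a * d1 u t x + d1 w t x + b * d1 y t x"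
  using assms unfolding partially_differentiable_def dt_def d1_def
  by (auto intro!: DERIV_imp_deriv DERIV_add DERIV_cmult
      simp flip: DERIV_deriv_iff_real_differentiable)

lemma transport_transport:
  assumes "tangentially_regular u"
  shows "transport \<gamma> v (transport \<gamma> v u) = (\<lambda>t x.
    \<gamma>\<^sup>2 * u t x + 2 * \<gamma> * dt u t x + 2 * \<gamma> * v * d1 u t x + dt (dt u) t x
      + v * dt (d1 u) t x + v * d1 (dt u) t x + v\<^sup>2 * d1 (d1 u) t x)"
proof (intro ext)
  fix t x
  have reg: "partially_differentiable u" "partially_differentiable (dt u)"
      "partially_differentiable (d1 u)"
    using assms by (auto simp: tangentially_regular_def)
  have eq: "transport \<gamma> v u = (\<lambda>t x. \<gamma> * u t x + dt u t x + v * d1 u t x)"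
    by (simp add: transport_def fun_eq_iff)
  show "transport \<gamma> v (transport \<gamma> v u) t x =
    \<gamma>\<^sup>2 * u t x + 2 * \<gamma> * dt u t x + 2 * \<gamma> * v * d1 u t x + dt (dt u) t x
      + v * dt (d1 u) t x + v * d1 (dt u) t x + v\<^sup>2 * d1 (d1 u) t x"
    unfolding transport_def[of _ _ "transport \<gamma> v u"] unfolding eq dt_d1_linear_combination[OF reg]
    by (simp add: algebra_simps power2_eq_square)
qed

lemma integrable2_transport_transport:
  assumes "tangentially_regular u"
  shows "integrable2 (transport \<gamma> v (transport \<gamma> v u))"
  using assms unfolding transport_transport[OF assms]
  by (intro integrable2_add integrable2_scale) (auto simp: tangentially_regular_def)

text \<open>The symbol of \<open>\<gamma> + \<partial>\<^sub>t + v \<partial>\<^sub>1\<close> is \<open>\<tau> + i v \<eta>\<close>. The operator is expanded into monomials first,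
  since the second order multipliers are available for each mixed derivative separately; the two
  mixed derivatives need not agree pointwise but have the same transform.\<close>

lemma fourier_transport_transport:
  assumes "tangentially_regular u"
  shows "fourier (transport \<gamma> v (transport \<gamma> v u)) \<delta> \<eta>
    = (Complex \<gamma> \<delta> + \<i> * of_real v * of_real \<eta>)\<^sup>2 * fourier u \<delta> \<eta>"
proof -
  have int: "integrable2 u" "integrable2 (dt u)" "integrable2 (d1 u)" "integrable2 (dt (dt u))"
      "integrable2 (dt (d1 u))" "integrable2 (d1 (dt u))" "integrable2 (d1 (d1 u))"
    using assms by (auto simp: tangentially_regular_def)
  have \<tau>: "Complex \<gamma> \<delta> = of_real \<gamma> + \<i> * of_real \<delta>"
    by (simp add: complex_eq_iff)
  show ?thesis
    unfolding transport_transport[OF assms] \<tau>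
    by (simp add: fourier_add fourier_scale integrable2_add integrable2_scale int
        fourier_tangential_derivatives[OF assms]) (simp add: power2_eq_square algebra_simps)
qed

lemma fourier_transport_d1:
  assumes "tangentially_regular u"
  shows "fourier (transport \<gamma> 0 (d1 u)) \<delta> \<eta> = Complex \<gamma> \<delta> * (\<i> * of_real \<eta>) * fourier u \<delta> \<eta>"
proof -
  have int: "integrable2 (d1 u)" "integrable2 (dt (d1 u))"
    using assms by (auto simp: tangentially_regular_def)
  have eq: "transport \<gamma> 0 (d1 u) = (\<lambda>t x. \<gamma> * d1 u t x + dt (d1 u) t x)"
    by (simp add: transport_def fun_eq_iff)
  have \<tau>: "Complex \<gamma> \<delta> = of_real \<gamma> + \<i> * of_real \<delta>"
    by (simp add: complex_eq_iff)
  show ?thesis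
    unfolding eq \<tau>
    by (simp add: fourier_add fourier_scale integrable2_scale int
        fourier_tangential_derivatives[OF assms] algebra_simps)
qed

section \<open>Normal derivatives of Fourier transformed slices\<close>

lemma tendsto_fourier_dominated:
  assumes u: "\<And>n. integrable2 (u n)" and w: "integrable2 w" and G: "integrable2 G"
    and le: "\<And>n t x. \<bar>u n t x\<bar> \<le> G t x"
    and lim: "\<And>t x. (\<lambda>n. u n t x) \<longlonglongrightarrow> w t x"
  shows "(\<lambda>n. fourier (u n) \<delta> \<eta>) \<longlonglongrightarrow> fourier w \<delta> \<eta>"
  unfolding fourier_def
proof (rule integral_dominated_convergence)
  show "integrable lborel (\<lambda>q. G (fst q) (snd q))"
    using G by (simp add: integrable2_def)
  show "AE q in lborel. (\<lambda>n. phase \<delta> \<eta> q * complex_of_real (u n (fst q) (snd q)))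
      \<longlonglongrightarrow> phase \<delta> \<eta> q * complex_of_real (w (fst q) (snd q))"
    by (intro AE_I2 tendsto_mult tendsto_const tendsto_of_real lim)
  show "AE q in lborel. norm (phase \<delta> \<eta> q * complex_of_real (u n (fst q) (snd q)))
      \<le> G (fst q) (snd q)" for n
    using le by (simp add: norm_mult)
  show "(\<lambda>q. phase \<delta> \<eta> q * complex_of_real (w (fst q) (snd q))) \<in> borel_measurable lborel"
    by (rule borel_measurable_integrable[OF integrable_phase_mult[OF w]])
  show "(\<lambda>q. phase \<delta> \<eta> q * complex_of_real (u n (fst q) (snd q))) \<in> borel_measurable lborel" for n
    by (rule borel_measurable_integrable[OF integrable_phase_mult[OF u]])
qed

lemma bounded_fourier_slices:
  assumes "dominated_slices Z \<phi>"
  shows "\<exists>C. \<forall>z\<in>Z. \<bar>z\<bar> \<le> R \<longrightarrow> norm (fourier (\<phi> z) \<delta> \<eta>) \<le> C"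
proof -
  obtain G where "integrable2 G" "\<And>z t x. z \<in> Z \<Longrightarrow> \<bar>z\<bar> \<le> R \<Longrightarrow> \<bar>\<phi> z t x\<bar> \<le> G t x"
    using assms unfolding dominated_slices_def by blast
  then have "norm (fourier (\<phi> z) \<delta> \<eta>) \<le> (\<integral>q. G (fst q) (snd q) \<partial>lborel)"
    if "z \<in> Z" "\<bar>z\<bar> \<le> R" for z
    using assms that by (intro norm_fourier_le) (auto simp: dominated_slices_def)
  then show ?thesis by blast
qed

text \<open>The majorant is only uniform on bounded sets of \<open>x\<^sub>3\<close>. A convergent sequence and its limit lie in
  one such set, which suffices for dominated convergence.\<close>

lemma dominated_slices_along_sequence:
  assumes dom: "dominated_slices Z \<phi>" and lim: "X \<longlonglongrightarrow> z" and z: "z \<in> Z" and X: "\<And>n. X n \<in> Z"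
  obtains R G where "integrable2 G" "\<And>n. \<bar>X n\<bar> \<le> R" "\<bar>z\<bar> \<le> R"
    "\<And>y t x. y \<in> Z \<Longrightarrow> \<bar>y\<bar> \<le> R \<Longrightarrow> \<bar>\<phi> y t x\<bar> \<le> G t x"
proof -
  obtain R where R: "\<And>n. norm (X n) \<le> R"
    using Bseq_def convergent_imp_Bseq[of X] lim convergentI by metis
  have Rz: "\<bar>z\<bar> \<le> R"
    using LIMSEQ_le_const2[OF tendsto_norm[OF lim]] R by auto
  obtain G where "integrable2 G" "\<And>y t x. y \<in> Z \<Longrightarrow> \<bar>y\<bar> \<le> R \<Longrightarrow> \<bar>\<phi> y t x\<bar> \<le> G t x"
    using dom unfolding dominated_slices_def by blast
  then show thesis
    using R Rz by (intro that) auto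
qed

lemma continuous_on_fourier_slices:
  assumes dom: "dominated_slices Z \<phi>" and cont: "\<And>t x. continuous_on Z (\<lambda>z. \<phi> z t x)"
  shows "continuous_on Z (\<lambda>z. fourier (\<phi> z) \<delta> \<eta>)"
  unfolding continuous_on_sequentially
proof (intro allI ballI impI)
  fix X z assume z: "z \<in> Z" and X: "(\<forall>n. X n \<in> Z) \<and> X \<longlonglongrightarrow> z"
  obtain R G where G: "integrable2 G" "\<And>n. \<bar>X n\<bar> \<le> R"
      "\<And>y t x. y \<in> Z \<Longrightarrow> \<bar>y\<bar> \<le> R \<Longrightarrow> \<bar>\<phi> y t x\<bar> \<le> G t x"
    using dominated_slices_along_sequence[OF dom _ z] X by metis
  have "(\<lambda>n. fourier (\<phi> (X n)) \<delta> \<eta>) \<longlonglongrightarrow> fourier (\<phi> z) \<delta> \<eta>"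
  proof (rule tendsto_fourier_dominated[OF _ _ G(1)])
    show "(\<lambda>n. \<phi> (X n) t x) \<longlonglongrightarrow> \<phi> z t x" for t x
      using cont[of t x] z X by (auto simp: continuous_on_sequentially o_def)
  qed (use X z G dom in \<open>auto simp: dominated_slices_def\<close>)
  then show "((\<lambda>z. fourier (\<phi> z) \<delta> \<eta>) \<circ> X) \<longlonglongrightarrow> fourier (\<phi> z) \<delta> \<eta>"
    by (simp add: o_def)
qed

text \<open>The mean value inequality on the convex set \<open>Z\<close> bounds the difference quotients of \<open>\<phi>\<close> by the
  majorant of \<open>\<phi>'\<close>, so dominated convergence applies to them along any sequence.\<close>

lemma has_vector_derivative_fourier_slices:
  assumes conv: "convex Z" and int: "\<And>z. z \<in> Z \<Longrightarrow> integrable2 (\<phi> z)"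
    and dom: "dominated_slices Z \<phi>'"
    and der: "\<And>z t x. z \<in> Z \<Longrightarrow> ((\<lambda>r. \<phi> r t x) has_vector_derivative \<phi>' z t x) (at z within Z)"
    and z: "z \<in> Z"
  shows "((\<lambda>r. fourier (\<phi> r) \<delta> \<eta>) has_vector_derivative fourier (\<phi>' z) \<delta> \<eta>) (at z within Z)"
  unfolding has_vector_derivative_within_iff_slope tendsto_at_iff_sequentially
proof (intro allI impI)
  fix X assume X: "\<forall>i. X i \<in> Z - {z}" and lim: "X \<longlonglongrightarrow> z"
  obtain R G where G: "integrable2 G" "\<And>n. \<bar>X n\<bar> \<le> R" "\<bar>z\<bar> \<le> R"
      "\<And>y t x. y \<in> Z \<Longrightarrow> \<bar>y\<bar> \<le> R \<Longrightarrow> \<bar>\<phi>' y t x\<bar> \<le> G t x"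
    using dominated_slices_along_sequence[OF dom lim z] X by (metis DiffD1)
  define u where "u n t x = inverse (X n - z) * (\<phi> (X n) t x - \<phi> z t x)" for n t x
  have "(\<lambda>n. fourier (u n) \<delta> \<eta>) \<longlonglongrightarrow> fourier (\<phi>' z) \<delta> \<eta>"
  proof (rule tendsto_fourier_dominated[OF _ _ G(1)])
    show "integrable2 (u n)" for n
      unfolding u_def using X z by (intro integrable2_scale integrable2_diff int) auto
    show "integrable2 (\<phi>' z)"
      using dom z by (simp add: dominated_slices_def)
    show "(\<lambda>n. u n t x) \<longlonglongrightarrow> \<phi>' z t x" for t x
      using der[OF z, of t x] X lim
      unfolding has_vector_derivative_within_iff_slope tendsto_at_iff_sequentially u_def o_def
      by simp
    show "\<bar>u n t x\<bar> \<le> G t x" for n t x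
    proof -
      have "norm (\<phi> (X n) t x - \<phi> z t x) \<le> G t x * norm (X n - z)"
      proof (rule differentiable_bound[where S = "Z \<inter> {-R..R}" and f' = "\<lambda>y h. h *\<^sub>R \<phi>' y t x"])
        show "convex (Z \<inter> {-R..R})"
          by (intro convex_Int conv) (simp add: convex_real_interval)
        fix y assume y: "y \<in> Z \<inter> {-R..R}"
        show "((\<lambda>r. \<phi> r t x) has_derivative (\<lambda>h. h *\<^sub>R \<phi>' y t x)) (at y within Z \<inter> {-R..R})"
          using has_vector_derivative_within_subset[OF der, of y "Z \<inter> {-R..R}" t x] y
          by (simp add: has_vector_derivative_def)
        have "\<bar>\<phi>' y t x\<bar> \<le> G t x" using G(4)[of y t x] y by auto
        then show "onorm (\<lambda>h. h *\<^sub>R \<phi>' y t x) \<le> G t x"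
          by (intro onorm_le) (simp add: abs_mult mult.commute[of "G t x"] mult_left_mono)
      qed (use X z G(2)[of n] G(3) in auto)
      moreover have "X n \<noteq> z" using X by auto
      ultimately show ?thesis
        by (simp add: u_def abs_mult field_simps)
    qed
  qed
  moreover have "fourier (u n) \<delta> \<eta>
      = inverse (X n - z) *\<^sub>R (fourier (\<phi> (X n)) \<delta> \<eta> - fourier (\<phi> z) \<delta> \<eta>)" for n
    unfolding u_def fourier_scale using X z
    by (subst fourier_diff) (auto intro!: int simp: scaleR_conv_of_real)
  ultimately show "((\<lambda>y. inverse (y - z) *\<^sub>R (fourier (\<phi> y) \<delta> \<eta> - fourier (\<phi> z) \<delta> \<eta>)) \<circ> X)
      \<longlonglongrightarrow> fourier (\<phi>' z) \<delta> \<eta>"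
    by (simp add: o_def)
qed

lemma convex_half_line: "convex (half_line s)" and convex_open_half_line: "convex (open_half_line s)"
proof -
  have "half_line Plus = {0..}" "half_line Minus = {..0}"
      "open_half_line Plus = {0<..}" "open_half_line Minus = {..<0}"
    by (auto simp: half_line_def open_half_line_def)
  then show "convex (half_line s)" "convex (open_half_line s)"
    by (cases s; simp add: convex_real_interval)+
qed

lemma open_open_half_line: "open (open_half_line s)"
  unfolding open_half_line_def by (intro open_Collect_less continuous_intros)

lemma open_half_line_subset: "open_half_line s \<subseteq> half_line s"
  by (auto simp: half_line_def open_half_line_def)

lemma at_within_half_line: "z \<in> open_half_line s \<Longrightarrow> at z within half_line s = at z"
  by (meson at_within_interior interiorI open_half_line_subset open_open_half_line)

lemma bulk_regular_fourier:
  assumes reg: "bulk_regular s \<phi>"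
  shows "z \<in> half_line s \<Longrightarrow> ((\<lambda>r. fourier (\<phi> r) \<delta> \<eta>) has_vector_derivative
      fourier (d3 s \<phi> z) \<delta> \<eta>) (at z within half_line s)"
    and "continuous_on (half_line s) (\<lambda>z. fourier (d3 s \<phi> z) \<delta> \<eta>)"
    and "z \<in> open_half_line s \<Longrightarrow> ((\<lambda>r. fourier (d3 s \<phi> r) \<delta> \<eta>) has_vector_derivative
      fourier (d3 s (d3 s \<phi>) z) \<delta> \<eta>) (at z)"
proof -
  have dom: "dominated_slices (half_line s) \<phi>" "dominated_slices (half_line s) (d3 s \<phi>)"
      "dominated_slices (open_half_line s) (d3 s (d3 s \<phi>))"
    using reg by (auto simp: bulk_regular_def)
  show "((\<lambda>r. fourier (\<phi> r) \<delta> \<eta>) has_vector_derivative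
      fourier (d3 s \<phi> z) \<delta> \<eta>) (at z within half_line s)" if "z \<in> half_line s"
  proof (rule has_vector_derivative_fourier_slices[OF convex_half_line _ dom(2) _ that])
    show "((\<lambda>r. \<phi> r t x) has_vector_derivative d3 s \<phi> z t x) (at z within half_line s)"
      if "z \<in> half_line s" for z t x
      using reg that by (auto simp: bulk_regular_def d3_def vector_derivative_works[symmetric])
  qed (use dom in \<open>auto simp: dominated_slices_def\<close>)
  show "continuous_on (half_line s) (\<lambda>z. fourier (d3 s \<phi> z) \<delta> \<eta>)"
    by (rule continuous_on_fourier_slices[OF dom(2)]) (use reg in \<open>auto simp: bulk_regular_def\<close>)
  show "((\<lambda>r. fourier (d3 s \<phi> r) \<delta> \<eta>) has_vector_derivative
      fourier (d3 s (d3 s \<phi>) z) \<delta> \<eta>) (at z)" if z: "z \<in> open_half_line s"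
  proof -
    have "((\<lambda>r. fourier (d3 s \<phi> r) \<delta> \<eta>) has_vector_derivative
        fourier (d3 s (d3 s \<phi>) z) \<delta> \<eta>) (at z within open_half_line s)"
    proof (rule has_vector_derivative_fourier_slices[OF convex_open_half_line _ dom(3) _ z])
      show "((\<lambda>r. d3 s \<phi> r t x) has_vector_derivative d3 s (d3 s \<phi>) z t x)
          (at z within open_half_line s)" if z: "z \<in> open_half_line s" for z t x
        unfolding d3_def[of s "d3 s \<phi>"] at_within_half_line[OF z] at_within_open[OF z open_open_half_line]
        using reg z by (auto simp: bulk_regular_def vector_derivative_works[symmetric])
    qed (use dom open_half_line_subset[of s] in \<open>auto simp: dominated_slices_def\<close>)
    then show ?thesis
      by (simp add: at_within_open[OF z open_open_half_line])
  qed
qed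

section \<open>The transformed bulk problem\<close>

text \<open>
  The identity for one side, in terms of the total pressure \<open>Q\<close>. The variable \<open>y = |x\<^sub>3|\<close> maps either
  side to the positive half line, and the factor \<open>sg s\<close> comes from the chain rule. Working with \<open>Q\<close>
  rather than \<open>h\<close> avoids having to extend \<open>B2^ = B h^\<close> and its normal derivative to \<open>x\<^sub>3 = 0\<close>.
\<close>

lemma bulk_boundary_identity:
  fixes \<gamma> \<rho> c CB v B :: real and h b K :: "real \<Rightarrow> real \<Rightarrow> real \<Rightarrow> real"
  assumes \<gamma>: "\<gamma> > 0" and CB: "CB > 0" "CB\<^sup>2 = c\<^sup>2 + B\<^sup>2 / \<rho>"
    and h_reg: "bulk_regular s h" and b_reg: "bulk_regular s b"
    and wave: "\<And>z t x. z \<in> open_half_line s \<Longrightarrow>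
        transport \<gamma> v (transport \<gamma> v (h z)) t x - c\<^sup>2 * lap13 s h z t x
        - B / \<rho> * lap13 s b z t x = K z t x"
    and magnetic: "\<And>z t x. z \<in> open_half_line s \<Longrightarrow>
        transport \<gamma> v (transport \<gamma> v (b z)) t x
        - B * transport \<gamma> v (transport \<gamma> v (h z)) t x = 0"
    and h_decay: "((\<lambda>y. fourier (h (sg s * y)) \<delta> \<eta>) \<longlongrightarrow> 0) at_top"
    and K_decay: "((\<lambda>y. fourier (K (sg s * y)) \<delta> \<eta>) \<longlongrightarrow> 0) at_top"
  defines "\<tau> \<equiv> Complex \<gamma> \<delta>"
  shows "set_integrable lborel {0<..} (source_integrand CB v s K \<tau> \<eta>)" (is ?int)
    and "(LBINT y:{0<..}. source_integrand CB v s K \<tau> \<eta> y)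
      = of_real (sg s) * fourier (\<lambda>t x. c\<^sup>2 * d3 s h 0 t x + B / \<rho> * d3 s b 0 t x) \<delta> \<eta>
        + mu CB v \<tau> \<eta> * fourier (\<lambda>t x. c\<^sup>2 * h 0 t x + B / \<rho> * b 0 t x) \<delta> \<eta>" (is ?eq)
proof -
  define \<mu> where "\<mu> = mu CB v \<tau> \<eta>"
  define a where "a = \<tau> + \<i> * of_real v * of_real \<eta>"
  define Q where "Q z = of_real (c\<^sup>2) * fourier (h z) \<delta> \<eta> + of_real (B / \<rho>) * fourier (b z) \<delta> \<eta>" for z
  define Q1 where "Q1 z = of_real (c\<^sup>2) * fourier (d3 s h z) \<delta> \<eta>
    + of_real (B / \<rho>) * fourier (d3 s b z) \<delta> \<eta>" for z
  define Q2 where "Q2 z = of_real (c\<^sup>2) * fourier (d3 s (d3 s h) z) \<delta> \<eta>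
    + of_real (B / \<rho>) * fourier (d3 s (d3 s b) z) \<delta> \<eta>" for z
  have Re\<mu>: "Re \<mu> > 0"
    unfolding \<mu>_def \<tau>_def by (rule Re_mu_pos) (use \<gamma> CB in auto)
  \<comment> \<open>The definition of the root, cleared of the denominator \<open>CB\<^sup>2\<close>.\<close>
  have \<mu>2: "(of_real CB)\<^sup>2 * \<mu>\<^sup>2 = a\<^sup>2 + (of_real CB)\<^sup>2 * (of_real \<eta>)\<^sup>2"
    using CB unfolding \<mu>_def mu_def a_def power2_csqrt by (simp add: field_simps)
  have a0: "a \<noteq> 0"
    using \<gamma> by (auto simp: a_def \<tau>_def complex_eq_iff)
  have CBc: "(of_real CB)\<^sup>2 = (of_real (c\<^sup>2) + of_real (B / \<rho>) * of_real B :: complex)"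
    using arg_cong[OF CB(2), of complex_of_real] by (simp add: power2_eq_square)
  have reg: "tangentially_regular (h z)" "tangentially_regular (b z)"
      "integrable2 (d1 (d1 (h z)))" "integrable2 (d1 (d1 (b z)))"
      "integrable2 (d3 s (d3 s h) z)" "integrable2 (d3 s (d3 s b) z)"
    if "z \<in> open_half_line s" for z
    using h_reg b_reg that
    by (auto simp: bulk_regular_def dominated_slices_def tangentially_regular_def)
  have b_eq: "fourier (b z) \<delta> \<eta> = of_real B * fourier (h z) \<delta> \<eta>" if z: "z \<in> open_half_line s" for z
  proof -
    have "transport \<gamma> v (transport \<gamma> v (b z)) = (\<lambda>t x. B * transport \<gamma> v (transport \<gamma> v (h z)) t x)"
      using magnetic[OF z] by (simp add: fun_eq_iff)
    from arg_cong[OF this, of "\<lambda>u. fourier u \<delta> \<eta>"]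
    have "a\<^sup>2 * fourier (b z) \<delta> \<eta> = of_real B * (a\<^sup>2 * fourier (h z) \<delta> \<eta>)"
      unfolding fourier_scale fourier_transport_transport[OF reg(1)[OF z]]
        fourier_transport_transport[OF reg(2)[OF z]] a_def \<tau>_def .
    then show ?thesis
      using a0 by (simp add: mult.left_commute)
  qed
  have Q_eq: "Q z = (of_real CB)\<^sup>2 * fourier (h z) \<delta> \<eta>" if z: "z \<in> open_half_line s" for z
    unfolding Q_def b_eq[OF z] CBc by (simp add: algebra_simps)
  have K_eq: "fourier (K z) \<delta> \<eta> = \<mu>\<^sup>2 * Q z - Q2 z" if z: "z \<in> open_half_line s" for z
  proof -
    have "K z = (\<lambda>t x. transport \<gamma> v (transport \<gamma> v (h z)) t x
        - c\<^sup>2 * (d1 (d1 (h z)) t x + d3 s (d3 s h) z t x)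
        - B / \<rho> * (d1 (d1 (b z)) t x + d3 s (d3 s b) z t x))"
      using wave[OF z] by (simp add: fun_eq_iff lap13_def)
    then have "fourier (K z) \<delta> \<eta> = a\<^sup>2 * fourier (h z) \<delta> \<eta>
        - of_real (c\<^sup>2) * ((\<i> * of_real \<eta>)\<^sup>2 * fourier (h z) \<delta> \<eta> + fourier (d3 s (d3 s h) z) \<delta> \<eta>)
        - of_real (B / \<rho>) * ((\<i> * of_real \<eta>)\<^sup>2 * fourier (b z) \<delta> \<eta> + fourier (d3 s (d3 s b) z) \<delta> \<eta>)"
      by (simp only: fourier_diff fourier_add fourier_scale integrable2_add integrable2_scale
          integrable2_diff integrable2_transport_transport reg[OF z]
          fourier_transport_transport[OF reg(1)[OF z]] fourier_tangential_derivatives(6)[OF reg(1)[OF z]]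
          fourier_tangential_derivatives(6)[OF reg(2)[OF z]] a_def \<tau>_def)
    also have "\<dots> = a\<^sup>2 * fourier (h z) \<delta> \<eta> + (of_real \<eta>)\<^sup>2 * Q z - Q2 z"
      unfolding Q_def Q2_def by (simp add: power_mult_distrib algebra_simps)
    also have "\<dots> = ((of_real CB)\<^sup>2 * \<mu>\<^sup>2) * fourier (h z) \<delta> \<eta> - Q2 z"
      unfolding \<mu>2 Q_eq[OF z] by (simp add: algebra_simps)
    finally show ?thesis
      unfolding Q_eq[OF z] by (simp add: algebra_simps)
  qed
  have sg: "sg s * sg s = 1" "\<bar>sg s * y\<bar> = \<bar>y\<bar>" "of_real (sg s) * (of_real (sg s) * w) = (w::complex)" for y w
    by (cases s; simp)+
  have mem: "0 \<le> y \<Longrightarrow> sg s * y \<in> half_line s" "0 < y \<Longrightarrow> sg s * y \<in> open_half_line s" for y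
    by (simp_all add: half_line_def open_half_line_def mult.assoc[symmetric] sg)
  have scale: "((\<lambda>y. sg s * y) has_vector_derivative sg s) F" for F
    by (cases s) (auto intro!: derivative_eq_intros)
  have dQ: "(Q has_vector_derivative Q1 z) (at z within half_line s)" if "z \<in> half_line s" for z
    unfolding Q_def Q1_def using that
    by (intro has_vector_derivative_add has_vector_derivative_mult_right
        bulk_regular_fourier(1) h_reg b_reg)
  have dQ1: "(Q1 has_vector_derivative Q2 z) (at z)" if "z \<in> open_half_line s" for z
    unfolding Q1_def Q2_def using that
    by (intro has_vector_derivative_add has_vector_derivative_mult_right
        bulk_regular_fourier(3) h_reg b_reg)
  have cQ1: "continuous_on (half_line s) Q1"
    unfolding Q1_def by (intro continuous_intros bulk_regular_fourier(2) h_reg b_reg)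
  define g where "g y = Q (sg s * y)" for y
  define g1 where "g1 y = of_real (sg s) * Q1 (sg s * y)" for y
  define k where "k y = fourier (K (sg s * y)) \<delta> \<eta>" for y
  have der: "(g has_vector_derivative g1 y) (at y within {0..})" if "0 \<le> y" for y
  proof -
    have "(Q has_vector_derivative Q1 (sg s * y)) (at (sg s * y) within (\<lambda>y. sg s * y) ` {0..})"
      by (rule has_vector_derivative_within_subset[OF dQ[OF mem(1)[OF that]]]) (use mem in auto)
    from vector_diff_chain_within[OF scale this] show ?thesis
      by (simp add: g_def[abs_def] g1_def o_def scaleR_conv_of_real)
  qed
  have der1: "(g1 has_vector_derivative \<mu>\<^sup>2 * g y - k y) (at y)" if "0 < y" for y
  proof -
    have "\<mu>\<^sup>2 * g y - k y = Q2 (sg s * y)"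
      by (simp add: g_def k_def K_eq[OF mem(2)[OF that]])
    moreover have "(g1 has_vector_derivative of_real (sg s) * (sg s *\<^sub>R Q2 (sg s * y))) (at y)"
      unfolding g1_def using vector_diff_chain_at[OF scale dQ1[OF mem(2)[OF that]]]
      by (intro has_vector_derivative_mult_right) (simp add: o_def)
    ultimately show ?thesis
      by (simp add: scaleR_conv_of_real sg)
  qed
  have cont1: "continuous_on {0..} g1"
    unfolding g1_def by (intro continuous_intros continuous_on_compose2[OF cQ1]) (use mem in auto)
  have g_decay: "(g \<longlongrightarrow> 0) at_top"
  proof (rule Lim_transform_eventually)
    show "((\<lambda>y. (of_real CB)\<^sup>2 * fourier (h (sg s * y)) \<delta> \<eta>) \<longlongrightarrow> 0) at_top"
      using tendsto_mult_right_zero[OF h_decay] .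
    show "eventually (\<lambda>y. (of_real CB)\<^sup>2 * fourier (h (sg s * y)) \<delta> \<eta> = g y) at_top"
      using eventually_gt_at_top[of 0] by eventually_elim (simp add: g_def Q_eq mem)
  qed
  \<comment> \<open>The equation itself bounds \<open>k\<close> near the boundary, since every other term in it is dominated.\<close>
  have k_bound: "\<exists>C. \<forall>y. 0 < y \<and> y \<le> R \<longrightarrow> norm (k y) \<le> C" for R
  proof -
    have dom: "dominated_slices (half_line s) h"
        "dominated_slices (open_half_line s) (d3 s (d3 s h))"
        "dominated_slices (open_half_line s) (d3 s (d3 s b))"
      using h_reg b_reg by (auto simp: bulk_regular_def)
    obtain C where C: "\<And>z. z \<in> half_line s \<Longrightarrow> \<bar>z\<bar> \<le> R \<Longrightarrow> norm (fourier (h z) \<delta> \<eta>) \<le> C"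
      using bounded_fourier_slices[OF dom(1)] by metis
    obtain C1 where C1: "\<And>z. z \<in> open_half_line s \<Longrightarrow> \<bar>z\<bar> \<le> R \<Longrightarrow>
        norm (fourier (d3 s (d3 s h) z) \<delta> \<eta>) \<le> C1"
      using bounded_fourier_slices[OF dom(2)] by metis
    obtain C2 where C2: "\<And>z. z \<in> open_half_line s \<Longrightarrow> \<bar>z\<bar> \<le> R \<Longrightarrow>
        norm (fourier (d3 s (d3 s b) z) \<delta> \<eta>) \<le> C2"
      using bounded_fourier_slices[OF dom(3)] by metis
    have "norm (k y) \<le> norm (\<mu>\<^sup>2 * (of_real CB)\<^sup>2) * C + (c\<^sup>2 * C1 + \<bar>B / \<rho>\<bar> * C2)"
      if y: "0 < y" "y \<le> R" for y
    proof -
      have k: "k y = \<mu>\<^sup>2 * (of_real CB)\<^sup>2 * fourier (h (sg s * y)) \<delta> \<eta> - Q2 (sg s * y)"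
        using y by (simp add: k_def K_eq mem Q_eq)
      have "norm (Q2 (sg s * y)) \<le> c\<^sup>2 * C1 + \<bar>B / \<rho>\<bar> * C2"
        unfolding Q2_def
      proof (rule norm_triangle_mono)
        show "norm (of_real (c\<^sup>2) * fourier (d3 s (d3 s h) (sg s * y)) \<delta> \<eta>) \<le> c\<^sup>2 * C1"
          unfolding norm_mult norm_of_real abs_power2
          by (intro mult_left_mono C1 mem) (use y sg in auto)
        show "norm (of_real (B / \<rho>) * fourier (d3 s (d3 s b) (sg s * y)) \<delta> \<eta>) \<le> \<bar>B / \<rho>\<bar> * C2"
          unfolding norm_mult norm_of_real
          by (intro mult_left_mono C2 mem) (use y sg in auto)
      qed
      moreover have "norm (\<mu>\<^sup>2 * (of_real CB)\<^sup>2 * fourier (h (sg s * y)) \<delta> \<eta>)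
          \<le> norm (\<mu>\<^sup>2 * (of_real CB)\<^sup>2) * C"
        unfolding norm_mult[of _ "fourier _ _ _"]
        by (intro mult_left_mono C mem) (use y sg in auto)
      ultimately show ?thesis
        unfolding k by (intro order_trans[OF norm_triangle_ineq4] add_mono)
    qed
    then show ?thesis by blast
  qed
  have src: "source_integrand CB v s K \<tau> \<eta> = (\<lambda>y. exp (- \<mu> * of_real y) * k y)"
    by (simp add: source_integrand_def fun_eq_iff \<mu>_def k_def \<tau>_def)
  note id = decaying_solution_boundary_identity[OF Re\<mu> der cont1 der1 g_decay K_decay[folded k_def] k_bound]
  show ?int unfolding src by (rule id(1))
  have "integrable2 (h 0)" "integrable2 (b 0)" "integrable2 (d3 s h 0)" "integrable2 (d3 s b 0)"
    using h_reg b_reg by (auto simp: bulk_regular_def dominated_slices_def half_line_def)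
  then have "of_real (sg s) * fourier (\<lambda>t x. c\<^sup>2 * d3 s h 0 t x + B / \<rho> * d3 s b 0 t x) \<delta> \<eta>
        + \<mu> * fourier (\<lambda>t x. c\<^sup>2 * h 0 t x + B / \<rho> * b 0 t x) \<delta> \<eta> = g1 0 + \<mu> * g 0"
    unfolding g_def g1_def Q_def Q1_def
    by (simp only: fourier_add fourier_scale integrable2_scale mult_zero_right)
  then show ?eq
    unfolding src using id(2) by (simp only: \<mu>_def)
qed

section \<open>The equation for the front\<close>

text \<open>The weighted source \<open>\<mu>p \<mu>m / (\<mu>p + \<mu>m) (P / \<mu>p + M / \<mu>m)\<close> is the mean of \<open>P\<close> and \<open>M\<close> with the weights
  \<open>\<mu>m\<close> and \<open>\<mu>p\<close>. It is the arithmetic mean, given by the front equation, minus a multiple of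
  \<open>P - M\<close>, which produces the term with \<open>(\<mu>p - \<mu>m) / (\<mu>p + \<mu>m)\<close>.\<close>

lemma front_symbol_identity:
  fixes \<mu>p \<mu>m \<tau> f P M Ip Im Q :: complex and v \<eta> :: real
  assumes nz: "\<mu>p \<noteq> 0" "\<mu>m \<noteq> 0" "\<mu>p + \<mu>m \<noteq> 0"
    and Ip: "Ip = P + \<mu>p * Q" and Im: "Im = - M + \<mu>m * Q"
    and sum: "\<tau>\<^sup>2 * f - (of_real v)\<^sup>2 * (of_real \<eta>)\<^sup>2 * f + (P + M) / 2 = 0"
    and diff: "P - M = - 4 * of_real v * (\<tau> * (\<i> * of_real \<eta>) * f)"
  shows "(\<tau>\<^sup>2 - (of_real v)\<^sup>2 * (of_real \<eta>)\<^sup>2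
      - 2 * \<i> * \<tau> * of_real \<eta> * of_real v * ((\<mu>p - \<mu>m) / (\<mu>p + \<mu>m))) * f
    + \<mu>p * \<mu>m / (\<mu>p + \<mu>m) * (Ip / \<mu>p - Im / \<mu>m) = 0"
proof -
  have "Ip / \<mu>p - Im / \<mu>m = P / \<mu>p + M / \<mu>m"
    using nz by (simp add: Ip Im field_simps)
  also have "\<mu>p * \<mu>m / (\<mu>p + \<mu>m) * (P / \<mu>p + M / \<mu>m) = (\<mu>m * P + \<mu>p * M) / (\<mu>p + \<mu>m)"
  proof -
    have "\<mu>p * \<mu>m * (P / \<mu>p + M / \<mu>m) = \<mu>m * P + \<mu>p * M"
      using nz by (simp add: field_simps)
    then show ?thesis by simp
  qed
  also have "\<mu>m * P + \<mu>p * M = (\<mu>p + \<mu>m) * ((P + M) / 2) - (\<mu>p - \<mu>m) * ((P - M) / 2)"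
    by (simp add: field_simps)
  also have "\<dots> / (\<mu>p + \<mu>m) = (P + M) / 2 - (\<mu>p - \<mu>m) / (\<mu>p + \<mu>m) * ((P - M) / 2)"
  proof -
    have "(s * p - d * q) / s = p - d / s * q" if "s \<noteq> 0" for s p d q :: complex
      using that by (simp add: diff_divide_distrib)
    then show ?thesis using nz(3) by blast
  qed
  finally have "\<mu>p * \<mu>m / (\<mu>p + \<mu>m) * (Ip / \<mu>p - Im / \<mu>m)
      = (P + M) / 2 + (\<mu>p - \<mu>m) / (\<mu>p + \<mu>m) * (2 * of_real v * (\<tau> * (\<i> * of_real \<eta>) * f))"
    unfolding diff by simp
  then show ?thesis
    using sum by (simp add: algebra_simps)
qed

theorem theorem2p1:
  fixes \<gamma> \<rho> c cA CB :: real
    and p :: "real \<Rightarrow> real"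
    and v B :: "side \<Rightarrow> real"
    and f :: "real \<Rightarrow> real \<Rightarrow> real"
    and h B2 K :: "side \<Rightarrow> real \<Rightarrow> real \<Rightarrow> real \<Rightarrow> real"
  assumes gamma: "\<gamma> \<ge> 1"
    and rho: "\<rho> > 0"
    and v: "v Minus = - v Plus"
    and B: "\<bar>B Plus\<bar> = \<bar>B Minus\<bar>"
    and pressure: "\<forall>r>0. p differentiable (at r) \<and> deriv p r > 0"
    and c: "c = sqrt (deriv p \<rho>)"
    and cA: "\<forall>s. cA\<^sup>2 = (B s)\<^sup>2 / \<rho>"
    and CB: "CB > 0" "CB\<^sup>2 = c\<^sup>2 + cA\<^sup>2"
    and f_regular: "tangentially_regular f"
    and h_regular: "\<forall>s. bulk_regular s (h s)"
    and B2_regular: "\<forall>s. bulk_regular s (B2 s)"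
    and K_decay: "\<forall>s \<delta> \<eta>. ((\<lambda>z. fourier (K s (sg s * z)) \<delta> \<eta>) \<longlongrightarrow> 0) at_top"
    and front: "\<forall>t x. transport \<gamma> 0 (transport \<gamma> 0 f) t x + (v Plus)\<^sup>2 * d1 (d1 f) t x
        + 1/2 * c\<^sup>2 * (d3 Plus (h Plus) 0 t x + d3 Minus (h Minus) 0 t x)
        + 1/2 * (B Plus / \<rho> * d3 Plus (B2 Plus) 0 t x + B Minus / \<rho> * d3 Minus (B2 Minus) 0 t x)
        = 0"
    and wave: "\<forall>s. \<forall>z\<in>open_half_line s. \<forall>t x.
        transport \<gamma> (v s) (transport \<gamma> (v s) (h s z)) t x - c\<^sup>2 * lap13 s (h s) z t x
        - B s / \<rho> * lap13 s (B2 s) z t x = K s z t x"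
    and magnetic: "\<forall>s. \<forall>z\<in>open_half_line s. \<forall>t x.
        transport \<gamma> (v s) (transport \<gamma> (v s) (B2 s z)) t x
        - B s * transport \<gamma> (v s) (transport \<gamma> (v s) (h s z)) t x = 0"
    and jump0: "\<forall>t x. jump (\<lambda>s. c\<^sup>2 * h s 0 t x + inverse \<rho> * B s * B2 s 0 t x) = 0"
    and jump1: "\<forall>t x. jump (\<lambda>s. c\<^sup>2 * d3 s (h s) 0 t x + inverse \<rho> * B s * d3 s (B2 s) 0 t x)
        = - 4 * v Plus * transport \<gamma> 0 (d1 f) t x"
    and h_decay: "\<forall>s \<delta> \<eta>. ((\<lambda>z. fourier (h s (sg s * z)) \<delta> \<eta>) \<longlongrightarrow> 0) at_top"
  shows "\<forall>\<delta> \<eta>. let \<tau> = Complex \<gamma> \<delta>;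
           \<mu>p = mu CB (v Plus) \<tau> \<eta>;
           \<mu>m = mu CB (v Minus) \<tau> \<eta>
         in (\<forall>s. set_integrable lborel {0<..} (source_integrand CB (v s) s (K s) \<tau> \<eta>)) \<and>
            (\<tau>\<^sup>2 - (of_real (v Plus))\<^sup>2 * (of_real \<eta>)\<^sup>2
              - 2 * \<i> * \<tau> * of_real \<eta> * of_real (v Plus) * ((\<mu>p - \<mu>m) / (\<mu>p + \<mu>m)))
              * fourier f \<delta> \<eta>
            + \<mu>p * \<mu>m / (\<mu>p + \<mu>m) * ((of_real CB)\<^sup>2 * W CB v K \<tau> \<eta>) = 0"
proof (intro allI, unfold Let_def)
  fix \<delta> \<eta> :: real
  define \<tau> where "\<tau> = Complex \<gamma> \<delta>"
  define I where "I s = (LBINT y:{0<..}. source_integrand CB (v s) s (K s) \<tau> \<eta> y)" for s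
  define N where "N s t x = c\<^sup>2 * d3 s (h s) 0 t x + B s / \<rho> * d3 s (B2 s) 0 t x" for s t x
  define D where "D s t x = c\<^sup>2 * h s 0 t x + B s / \<rho> * B2 s 0 t x" for s t x
  have \<gamma>0: "\<gamma> > 0" using gamma by simp
  have CB2: "CB\<^sup>2 = c\<^sup>2 + (B s)\<^sup>2 / \<rho>" for s
    using CB(2) cA by simp
  have id: "set_integrable lborel {0<..} (source_integrand CB (v s) s (K s) \<tau> \<eta>)"
      "I s = of_real (sg s) * fourier (N s) \<delta> \<eta> + mu CB (v s) \<tau> \<eta> * fourier (D s) \<delta> \<eta>" for s
    unfolding \<tau>_def I_def N_def[abs_def] D_def[abs_def]
    using bulk_boundary_identity[OF \<gamma>0 CB(1) CB2 h_regular[rule_format] B2_regular[rule_format]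
        wave[rule_format] magnetic[rule_format] h_decay[rule_format] K_decay[rule_format]]
    by blast+
  have int0: "integrable2 (h s 0)" "integrable2 (B2 s 0)"
      "integrable2 (d3 s (h s) 0)" "integrable2 (d3 s (B2 s) 0)" for s
    using h_regular B2_regular
    by (auto simp: bulk_regular_def dominated_slices_def half_line_def)
  have intN: "integrable2 (N s)" for s
    unfolding N_def[abs_def] by (intro integrable2_add integrable2_scale int0)
  have f2: "integrable2 (d1 (d1 f))"
    using f_regular by (simp add: tangentially_regular_def)
  have "D Plus = D Minus"
    using jump0 by (simp add: D_def[abs_def] fun_eq_iff jump_def field_simps)
  then have trace: "fourier (D Minus) \<delta> \<eta> = fourier (D Plus) \<delta> \<eta>"
    by simp
  have "(\<lambda>t x. N Plus t x - N Minus t x) = (\<lambda>t x. (- 4 * v Plus) * transport \<gamma> 0 (d1 f) t x)"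
    using jump1 by (simp add: N_def[abs_def] fun_eq_iff jump_def field_simps)
  from arg_cong[OF this, of "\<lambda>u. fourier u \<delta> \<eta>"]
  have diff: "fourier (N Plus) \<delta> \<eta> - fourier (N Minus) \<delta> \<eta>
      = - 4 * of_real (v Plus) * (\<tau> * (\<i> * of_real \<eta>) * fourier f \<delta> \<eta>)"
    unfolding fourier_diff[OF intN intN] fourier_scale fourier_transport_d1[OF f_regular] \<tau>_def
    by simp
  have "(\<lambda>t x. transport \<gamma> 0 (transport \<gamma> 0 f) t x + (v Plus)\<^sup>2 * d1 (d1 f) t x
      + 1/2 * (N Plus t x + N Minus t x)) = (\<lambda>t x. 0)"
    using front by (simp add: N_def[abs_def] fun_eq_iff algebra_simps)
  from arg_cong[OF this, of "\<lambda>u. fourier u \<delta> \<eta>"]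
  have sum: "\<tau>\<^sup>2 * fourier f \<delta> \<eta> - (of_real (v Plus))\<^sup>2 * (of_real \<eta>)\<^sup>2 * fourier f \<delta> \<eta>
      + (fourier (N Plus) \<delta> \<eta> + fourier (N Minus) \<delta> \<eta>) / 2 = 0"
    by (simp only: fourier_add fourier_scale fourier_zero integrable2_add integrable2_scale intN f2
        integrable2_transport_transport[OF f_regular] fourier_transport_transport[OF f_regular]
        fourier_tangential_derivatives(6)[OF f_regular]) (simp add: power_mult_distrib mult.assoc \<tau>_def)
  have pos: "Re (mu CB (v s) \<tau> \<eta>) > 0" for s
    by (rule Re_mu_pos) (use \<gamma>0 CB in \<open>auto simp: \<tau>_def\<close>)
  have nz: "mu CB (v Plus) \<tau> \<eta> \<noteq> 0" "mu CB (v Minus) \<tau> \<eta> \<noteq> 0"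
      "mu CB (v Plus) \<tau> \<eta> + mu CB (v Minus) \<tau> \<eta> \<noteq> 0"
    using pos[of Plus] pos[of Minus] by (auto simp: complex_eq_iff)
  have W: "(of_real CB)\<^sup>2 * W CB v K \<tau> \<eta>
      = I Plus / mu CB (v Plus) \<tau> \<eta> - I Minus / mu CB (v Minus) \<tau> \<eta>"
    using CB(1) nz unfolding W_def I_def[symmetric] by (simp add: field_simps)
  have Ip: "I Plus = fourier (N Plus) \<delta> \<eta> + mu CB (v Plus) \<tau> \<eta> * fourier (D Plus) \<delta> \<eta>"
    and Im: "I Minus = - fourier (N Minus) \<delta> \<eta> + mu CB (v Minus) \<tau> \<eta> * fourier (D Plus) \<delta> \<eta>"
    using id(2)[of Plus] id(2)[of Minus] trace by simp_all
  show "(\<forall>s. set_integrable lborel {0<..} (source_integrand CB (v s) s (K s) (Complex \<gamma> \<delta>) \<eta>)) \<and>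
      ((Complex \<gamma> \<delta>)\<^sup>2 - (of_real (v Plus))\<^sup>2 * (of_real \<eta>)\<^sup>2
        - 2 * \<i> * Complex \<gamma> \<delta> * of_real \<eta> * of_real (v Plus)
          * ((mu CB (v Plus) (Complex \<gamma> \<delta>) \<eta> - mu CB (v Minus) (Complex \<gamma> \<delta>) \<eta>)
            / (mu CB (v Plus) (Complex \<gamma> \<delta>) \<eta> + mu CB (v Minus) (Complex \<gamma> \<delta>) \<eta>)))
        * fourier f \<delta> \<eta>
      + mu CB (v Plus) (Complex \<gamma> \<delta>) \<eta> * mu CB (v Minus) (Complex \<gamma> \<delta>) \<eta>
        / (mu CB (v Plus) (Complex \<gamma> \<delta>) \<eta> + mu CB (v Minus) (Complex \<gamma> \<delta>) \<eta>)
        * ((of_real CB)\<^sup>2 * W CB v K (Complex \<gamma> \<delta>) \<eta>) = 0"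
    unfolding \<tau>_def[symmetric] W
    using id(1) front_symbol_identity[OF nz Ip Im sum diff] by blast
qed

end
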